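(* Let $n$ be an integer with $n>3$. Then there are exactly two new diagonal tight $\mathcal T(n)$-universal $\mathbb Z$-lattices (diagonal entries listed in nondecreasing order), namely $$X_n=\langle n,n+1,n+2,\dots,2n\rangle \quad\text{and}\quad Y_n=\langle n,n,n+1,n+2,\dots,2n-1\rangle.$$
   Context: A $\mathbb Z$-lattice is a free $\mathbb Z$-module of finite rank equipped with a positive definite symmetric bilinear form $B$ with values in $\mathbb Z$; write $Q(\bm x)=B(\bm x,\bm x)$. For positive integers $a_1,\dots,a_k$, the diagonal $\mathbb Z$-lattice $\langle a_1,\dots,a_k\rangle$ is $\mathbb Z^k$ with $Q(x_1,\dots,x_k)=a_1x_1^2+\dots+a_kx_k^2$. An integer $m$ is represented by $L$ if $m=Q(\bm x)$ for some $\bm x\in L$. For a positive integer $n$, $\mathcal T(n)$ denotes the set of all integers $\ge n$. $L$ is $\mathcal T(n)$-universal if it represents every element of $\mathcal T(n)$, and tight $\mathcal T(n)$-universal if the set of nonzero integers represented by $L$ equals $\mathcal T(n)$. A diagonal tight $\mathcal T(n)$-universal lattice $\langle a_1,\dots,a_k\rangle$ with $a_1\le\dots\le a_k$ is called new if for every proper subsequence $(a_{j_1},\dots,a_{j_l})$ of $(a_1,\dots,a_k)$ (i.e. $1\le j_1<\dots<j_l\le k$, $l<k$), the lattice $\langle a_{j_1},\dots,a_{j_l}\rangle$ is not $\mathcal T(n)$-universal. *)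

theory Defs
  imports Main "HOL-Library.Sublist"
begin

text \<open>
  The diagonal lattice \<open>\<langle>a\<^sub>1, \<dots>, a\<^sub>k\<rangle>\<close> is given by the list \<open>a\<close> of its diagonal entries;
  its vectors, the elements of \<open>\<int>\<^sup>k\<close>, are the integer lists of length \<open>k = length a\<close>.
\<close>

definition diag_vectors :: "int list \<Rightarrow> int list set" where
  "diag_vectors a = {x. length x = length a}"

definition diag_Q :: "int list \<Rightarrow> int list \<Rightarrow> int" where
  "diag_Q a x = (\<Sum>i<length a. a ! i * (x ! i)\<^sup>2)"

definition represents :: "int list \<Rightarrow> int \<Rightarrow> bool" where
  "represents a m \<longleftrightarrow> (\<exists>x\<in>diag_vectors a. m = diag_Q a x)"

definition \<T> :: "int \<Rightarrow> int set" where
  "\<T> n = {m. n \<le> m}"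

definition universal :: "int \<Rightarrow> int list \<Rightarrow> bool" where
  "universal n a \<longleftrightarrow> (\<forall>m\<in>\<T> n. represents a m)"

definition tight_universal :: "int \<Rightarrow> int list \<Rightarrow> bool" where
  "tight_universal n a \<longleftrightarrow> {m. m \<noteq> 0 \<and> represents a m} = \<T> n"

text \<open>
  The diagonal entries are required to be positive, so that the lattice is positive definite.
\<close>

definition new_tight_universal :: "int \<Rightarrow> int list \<Rightarrow> bool" where
  "new_tight_universal n a \<longleftrightarrow>
     (\<forall>c\<in>set a. 0 < c) \<and> sorted a \<and> tight_universal n a \<and>
     (\<forall>b. strict_subseq b a \<longrightarrow> \<not> universal n b)"

definition X :: "int \<Rightarrow> int list" where
  "X n = [n..2 * n]"

definition Y :: "int \<Rightarrow> int list" where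
  "Y n = n # [n..2 * n - 1]"

end

theory Submission
  imports Defs "HOL-Number_Theory.Number_Theory" "HOL-Computational_Algebra.Squarefree"
begin

text \<open>
  An entry \<open>c \<ge> n\<close> contributes \<open>c\<close> or at least \<open>4 n\<close>. So a lattice with entries at least \<open>n\<close> that represents
  \<open>n, \<dots>, 2 n\<close> must have \<open>n, \<dots>, 2 n - 1\<close> among its entries, and moreover the entry \<open>2 n\<close> or a second \<open>n\<close>:
  it contains \<open>X n\<close> or \<open>Y n\<close>. Both have \<open>n + 1\<close> entries, so everything follows once they are
  universal.

  For universality we look for orthogonal vectors that span \<open>N\<close> times a form representing whole residue
  classes, and correct \<open>m\<close> modulo \<open>N\<close> by vectors orthogonal to them. For \<open>n \<ge> 17\<close> the form is
  \<open>\<langle>1, 2, 4, 8\<rangle>\<close>, and this is uniform in \<open>n\<close>; for small \<open>n\<close> the vectors are found by a finite search, and for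
  \<open>n \<le> 8\<close> they need ternary forms such as \<open>\<langle>1, 4, 4\<rangle>\<close>. All these forms reduce to one fact: an
  \<open>n = 1\<close> modulo 4 is a sum of three squares. It is proved without Dirichlet's theorem on primes: for the
  quadratic character \<open>\<chi>\<close> attached to \<open>- n\<close>, some \<open>c = - 1\<close> modulo \<open>n\<close> has \<open>\<Sum>d dvd c. \<chi> d > 0\<close>, since
  otherwise \<open>L(1, \<chi>)\<close> would vanish; and such a \<open>c\<close> serves as well as the prime in the classical proof.
\<close>

section \<open>A sum over divisors that does not vanish on a residue class\<close>

text \<open>Three squares are needed only in the class 1 modulo 4: the other ternary forms arise
  from it by changes of variables, the quaternary ones through sums of four squares. The
  non-vanishing of L(1, chi) is elementary as well: the convolution \<open>R\<close> of 1 and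
  \<open>\<chi>\<close> is nonnegative and at least 1 on squares, so its power series is unbounded
  near 1, while vanishing would bound it by the modulus. The number \<open>c\<close> can stand in
  for a prime because only its primes of odd exponent matter; its square factor is absorbed by an
  off-diagonal entry of the Gram matrix. On the lattice side, \<open>X n\<close> and
  \<open>Y n\<close> share \<open>[n..2 * n - 1]\<close>. From \<open>n = 7\<close> on this common
  part represents every \<open>m \<ge> n\<close> except \<open>2 * n\<close>, so that one argument
  serves both. For \<open>n = 4\<close> it also misses 14, for \<open>n = 5\<close> also 25; up to
  \<open>n = 6\<close> the two lattices are therefore treated separately.\<close>

lemma count_cong_class:
  fixes q r x k :: nat
  assumes "q > 0"
  shows "real (x + 1) / real q - 1 \<le> real (card {e \<in> {1..x}. [e = r] (mod q)})"
    and "real (card {e \<in> {1..x}. [e = r] (mod q)}) \<le> real x / real q + 1"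
    and "card {e \<in> {1..q * k}. [e = r] (mod q)} = k"
proof -
  define f where "f = (\<lambda>x. card {e \<in> {1..x}. [e = r] (mod q)})"
  have step: "f (x + q) = f x + 1" for x
  proof -
    have bij: "bij_betw (\<lambda>e. e mod q) {x+1..x+q} {..<q}"
    proof (rule bij_betw_imageI)
      show "inj_on (\<lambda>e. e mod q) {x+1..x+q}"
      proof (rule inj_onI)
        fix a b assume "a \<in> {x+1..x+q}" "b \<in> {x+1..x+q}" "a mod q = b mod q"
        then show "a = b"
        proof (induction a b rule: linorder_wlog)
          case (le a b)
          then have "q dvd b - a" by (metis mod_eq_dvd_iff_nat)
          moreover have "b - a < q" using le by auto
          ultimately have "b - a = 0" by (meson nat_dvd_not_less neq0_conv)
          then show ?case using le by simp
        qed auto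
      qed
      then have "card ((\<lambda>e. e mod q) ` {x+1..x+q}) = card {..<q}"
        by (simp add: card_image)
      then show "(\<lambda>e. e mod q) ` {x+1..x+q} = {..<q}"
        by (intro card_subset_eq) (use assms in auto)
    qed
    have "r mod q \<in> {..<q}" using assms by simp
    then obtain e0 where e0: "e0 \<in> {x+1..x+q}" "e0 mod q = r mod q"
      using bij unfolding bij_betw_def by (metis imageE)
    have "{e \<in> {x+1..x+q}. [e = r] (mod q)} = {e0}"
      using bij e0 unfolding bij_betw_def inj_on_def cong_def by auto
    moreover have "{e \<in> {1..x+q}. [e = r] (mod q)} = {e \<in> {1..x}. [e = r] (mod q)} \<union> {e \<in> {x+1..x+q}. [e = r] (mod q)}"
      by auto
    moreover have "{e \<in> {1..x}. [e = r] (mod q)} \<inter> {e \<in> {x+1..x+q}. [e = r] (mod q)} = {}"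
      by auto
    ultimately show ?thesis
      unfolding f_def by (simp add: card_Un_disjoint)
  qed
  have mono: "f x \<le> f y" if "x \<le> y" for x y
    unfolding f_def by (rule card_mono) (use that in auto)
  have mult: "f (q * k) = k" for k
  proof (induction k)
    case 0 then show ?case by (simp add: f_def)
  next
    case (Suc k) then show ?case using step[of "q * k"] by (simp add: add.commute)
  qed
  show "card {e \<in> {1..q * k}. [e = r] (mod q)} = k"
    using mult[of k] by (simp add: f_def)
  \<comment> \<open>Rounding to multiples of \<open>q\<close>. The lower bound keeps
    \<open>x + 1\<close>, so that the count still differs from y / q by at most 1 when
    \<open>x\<close> is the integer part of a real number y.\<close>
  define k where "k = x div q"
  have "q * k \<le> x" by (simp add: k_def)
  moreover have "x + 1 \<le> q * (k + 1)"
    using dividend_less_times_div[OF assms, of x] by (simp add: k_def)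
  ultimately have "f (q * k) \<le> f x" "f x \<le> f (q * (k + 1))"
    by (auto intro!: mono)
  then have "k \<le> f x" "f x \<le> k + 1" by (simp_all only: mult)
  moreover have "real (q * k) \<le> real x" "real (x + 1) \<le> real (q * (k + 1))"
    using \<open>q * k \<le> x\<close> \<open>x + 1 \<le> q * (k + 1)\<close> of_nat_le_iff by blast+
  then have "real k \<le> real x / real q" "real (x + 1) / real q \<le> real k + 1"
    using assms by (simp_all add: field_simps)
  ultimately have "real (x + 1) / real q - 1 \<le> real (f x)" "real (f x) \<le> real x / real q + 1"
    by linarith+
  then show "real (x + 1) / real q - 1 \<le> real (card {e \<in> {1..x}. [e = r] (mod q)})"
    "real (card {e \<in> {1..x}. [e = r] (mod q)}) \<le> real x / real q + 1"
    by (simp_all add: f_def)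
qed

section \<open>Geometric sums and summation by parts\<close>

lemma geometric_sum_lower:
  fixes t :: real
  assumes "0 < t"
  shows "real n * sqrt (t ^ (n - 1)) \<le> (\<Sum>i<n. t ^ i)"
proof -
  have "(\<Sum>i<n. t ^ i) = (\<Sum>i<n. t ^ (n - 1 - i))"
    by (rule sum.reindex_bij_witness[of _ "\<lambda>i. n - 1 - i" "\<lambda>i. n - 1 - i"]) auto
  then have "2 * (\<Sum>i<n. t ^ i) = (\<Sum>i<n. t ^ i + t ^ (n - 1 - i))"
    by (simp add: sum.distrib)
  also have "\<dots> \<ge> (\<Sum>i<n. 2 * sqrt (t ^ (n - 1)))"
  proof (rule sum_mono)
    fix i assume "i \<in> {..<n}"
    then have "t ^ (n - 1) = t ^ i * t ^ (n - 1 - i)" by (simp add: power_add[symmetric])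
    then show "2 * sqrt (t ^ (n - 1)) \<le> t ^ i + t ^ (n - 1 - i)"
      using arith_geo_mean_sqrt[of "t ^ i" "t ^ (n - 1 - i)"] assms by simp
  qed
  finally show ?thesis by simp
qed

text \<open>Write \<open>s n\<close> for the geometric sum. As
  \<open>1 - t ^ n = (1 - t) * s n\<close>, this is, up to the factor \<open>1 - t\<close>, the
  difference of 1 / (n (1 - t)) and the Lambert weight t^n / (1 - t^n). The relation
  \<open>s (Suc n) - t * s n = 1\<close> makes consecutive quotients \<open>t ^ n / s n\<close>
  differ by \<open>t ^ n / (s n * s (Suc n))\<close>, which the lower bound for geometric sums keeps
  below 1 / n - 1 / (n + 1).\<close>

lemma geometric_defect_decreasing:
  fixes t :: real
  assumes "0 < t" "t < 1" "n > 0"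
  shows "1 / real (Suc n) - t ^ Suc n / (\<Sum>i<Suc n. t ^ i) \<le> 1 / real n - t ^ n / (\<Sum>i<n. t ^ i)"
    and "t ^ n / (\<Sum>i<n. t ^ i) \<le> 1 / real n"
proof -
  define s where "s = (\<lambda>n. \<Sum>i<n. t ^ i)"
  have s_lower: "real n * sqrt (t ^ (n - 1)) \<le> s n" for n
    unfolding s_def using assms(1) by (rule geometric_sum_lower)
  have root: "t ^ n \<le> sqrt (t ^ (n - 1)) * sqrt (t ^ n)"
  proof -
    have "sqrt (t ^ (n - 1)) * sqrt (t ^ n) = sqrt (t ^ (2 * n - 1))"
      using assms(3) by (simp add: real_sqrt_mult[symmetric] power_add[symmetric])
         (metis Suc_diff_1 add.commute add_Suc_right mult_2)
    moreover have "sqrt (t ^ (2 * n)) \<le> sqrt (t ^ (2 * n - 1))"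
      using assms by (intro real_sqrt_le_mono power_decreasing) auto
    moreover have "sqrt (t ^ (2 * n)) = t ^ n"
      using assms(1) by (simp add: power_mult[of t n 2, unfolded mult.commute[of n 2]] real_sqrt_abs)
    ultimately show ?thesis by simp
  qed
  have spos: "s n > 0" "s (Suc n) > 0"
    unfolding s_def by (rule sum_pos; use assms in auto)+
  have "real n * real (Suc n) * t ^ n \<le> (real n * sqrt (t ^ (n - 1))) * (real (Suc n) * sqrt (t ^ n))"
    using mult_left_mono[OF root, of "real n * real (Suc n)"] by (simp add: mult_ac)
  also have "\<dots> \<le> s n * s (Suc n)"
    using s_lower[of n] s_lower[of "Suc n"] spos assms(1) by (intro mult_mono) auto
  finally have key: "real n * real (Suc n) * t ^ n \<le> s n * s (Suc n)" .
  have rec: "s (Suc n) - t * s n = 1"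
  proof (induction n)
    case (Suc n)
    have "s (Suc n) = s n + t ^ n" "s (Suc (Suc n)) = s (Suc n) + t * t ^ n" by (simp_all add: s_def)
    moreover from this(1) have "t * s (Suc n) = t * s n + t * t ^ n" by (simp add: distrib_left)
    ultimately show ?case using Suc by linarith
  qed (simp add: s_def)
  have "t ^ n / s n - t ^ Suc n / s (Suc n) = t ^ n * (s (Suc n) - t * s n) / (s n * s (Suc n))"
    using spos by (simp add: field_simps)
  also have "\<dots> = t ^ n / (s n * s (Suc n))" by (simp add: rec)
  also have "\<dots> \<le> 1 / (real n * real (Suc n))"
    using key spos assms(3) by (simp add: divide_simps mult_ac)
  also have "\<dots> = 1 / real n - 1 / real (Suc n)"
    using assms(3) by (simp add: field_simps)
  finally show "1 / real (Suc n) - t ^ Suc n / (\<Sum>i<Suc n. t ^ i) \<le> 1 / real n - t ^ n / (\<Sum>i<n. t ^ i)"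
    by (simp add: s_def)
  have "real n * t ^ n = (\<Sum>i<n. t ^ n)" by simp
  also have "\<dots> \<le> s n" unfolding s_def
    using assms by (intro sum_mono power_decreasing) auto
  finally have "t ^ n / s n \<le> 1 / real n"
    using spos assms(3) by (simp add: field_simps)
  then show "t ^ n / (\<Sum>i<n. t ^ i) \<le> 1 / real n"
    by (simp add: s_def)
qed

lemma abel_bound:
  fixes a b :: "nat \<Rightarrow> real"
  assumes part: "\<And>m. \<bar>\<Sum>d\<in>{1..m}. a d\<bar> \<le> B"
    and dec: "\<And>n. n > 0 \<Longrightarrow> b (Suc n) \<le> b n" and nonneg: "\<And>n. n > 0 \<Longrightarrow> b n \<ge> 0"
  shows "\<bar>\<Sum>d\<in>{1..n}. a d * b d\<bar> \<le> B * b 1"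
proof -
  define A where "A = (\<lambda>m. \<Sum>d\<in>{1..m}. a d)"
  have eq: "(\<Sum>d\<in>{1..n}. a d * b d) = (\<Sum>d\<in>{1..n}. A d * (b d - b (Suc d))) + A n * b (Suc n)"
    by (induction n) (simp_all add: A_def algebra_simps)
  have "\<bar>\<Sum>d\<in>{1..n}. A d * (b d - b (Suc d))\<bar> \<le> (\<Sum>d\<in>{1..n}. B * (b d - b (Suc d)))"
  proof (rule order_trans[OF sum_abs], rule sum_mono)
    fix d assume "d \<in> {1..n}"
    then have "b d - b (Suc d) \<ge> 0" using dec[of d] by simp
    then show "\<bar>A d * (b d - b (Suc d))\<bar> \<le> B * (b d - b (Suc d))"
      using part[of d] by (simp add: abs_mult A_def mult_right_mono)
  qed
  moreover have "\<bar>A n * b (Suc n)\<bar> \<le> B * b (Suc n)"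
    using part[of n] nonneg[of "Suc n"] by (simp add: abs_mult A_def mult_right_mono)
  moreover have "(\<Sum>d\<in>{1..n}. B * (b d - b (Suc d))) + B * b (Suc n) = B * b 1"
    by (induction n) (simp_all add: algebra_simps)
  ultimately show ?thesis unfolding eq by linarith
qed

section \<open>Real nonprincipal Dirichlet characters and their divisor sums\<close>

locale real_char =
  fixes q :: nat and \<chi> :: "nat \<Rightarrow> int"
  assumes q_pos: "q > 0"
    and one: "\<chi> 1 = 1"
    and mult: "\<chi> (a * b) = \<chi> a * \<chi> b"
    and periodic: "\<chi> (a + q) = \<chi> a"
    and vals: "\<chi> a \<in> {-1, 0, 1}"
    and zero_iff: "\<chi> a = 0 \<longleftrightarrow> \<not> coprime a q"
    and nontrivial: "\<exists>b. \<chi> b = -1"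
begin

lemma cong_eq: assumes "[a = b] (mod q)" shows "\<chi> a = \<chi> b"
proof -
  have "\<chi> (a + q * k) = \<chi> a" for a k
  proof (induction k)
    case (Suc k)
    have "\<chi> (a + q * Suc k) = \<chi> (a + q * k + q)" by (simp add: algebra_simps)
    then show ?case using Suc periodic by simp
  qed simp
  then have "\<chi> a = \<chi> (a mod q)" for a
    by (metis mod_mult_div_eq)
  then show ?thesis using assms by (metis cong_def)
qed

text \<open>Multiplication by some \<open>b\<close> with \<open>\<chi> b = -1\<close> permutes the
  residues modulo \<open>q\<close> and changes the sign of the sum over a period.\<close>

lemma sum_period: "(\<Sum>d\<in>{1..q*k}. \<chi> d) = 0"
proof -
  have block: "(\<Sum>d<q. \<chi> d) = 0"
  proof -
    obtain b where b: "\<chi> b = -1" using nontrivial by blast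
    then have cop: "coprime b q" using zero_iff[of b] by auto
    have inj: "inj_on (\<lambda>d. (b * d) mod q) {..<q}"
    proof (rule inj_onI)
      fix x y assume "x \<in> {..<q}" "y \<in> {..<q}" "b * x mod q = b * y mod q"
      then have "[b * x = b * y] (mod q)" by (simp add: cong_def)
      then have "[x = y] (mod q)" using cop by (simp add: cong_mult_lcancel_nat)
      then show "x = y" using \<open>x \<in> _\<close> \<open>y \<in> _\<close> by (simp add: cong_def)
    qed
    then have "card ((\<lambda>d. (b * d) mod q) ` {..<q}) = card {..<q}"
      by (simp add: card_image)
    then have im: "(\<lambda>d. (b * d) mod q) ` {..<q} = {..<q}"
      by (intro card_subset_eq) (use q_pos in auto)
    have "(\<Sum>d<q. \<chi> d) = (\<Sum>d\<in>(\<lambda>d. (b * d) mod q) ` {..<q}. \<chi> d)" by (simp add: im)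
    also have "\<dots> = (\<Sum>d<q. \<chi> ((b * d) mod q))" using inj by (simp add: sum.reindex)
    also have "\<dots> = (\<Sum>d<q. \<chi> (b * d))" by (intro sum.cong refl cong_eq) (simp add: cong_def)
    also have "\<dots> = - (\<Sum>d<q. \<chi> d)" by (simp add: mult b sum_negf)
    finally show ?thesis by simp
  qed
  have "(\<Sum>d\<in>{1..q*k}. \<chi> d) = (\<Sum>d<q*k. \<chi> d)"
  proof -
    have "\<chi> (q * k) = \<chi> 0" by (rule cong_eq) (simp add: cong_def)
    moreover have "(\<Sum>d\<in>{1..q*k}. \<chi> d) + \<chi> 0 = (\<Sum>d<q*k. \<chi> d) + \<chi> (q*k)"
      by (metis One_nat_def add.commute atLeast0AtMost atLeast0LessThan le0 lessThan_Suc_atMost sum.atLeast_Suc_atMost sum.lessThan_Suc)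
    ultimately show ?thesis by simp
  qed
  also have "\<dots> = 0"
  proof (induction k)
    case (Suc k)
    have "(\<Sum>d<q * Suc k. \<chi> d) = (\<Sum>d<q*k. \<chi> d) + (\<Sum>d\<in>{q*k..<q*k+q}. \<chi> d)"
      by (metis (no_types, lifting) add.commute atLeast0LessThan le_add1 mult_Suc_right sum.atLeastLessThan_concat zero_le)
    also have "(\<Sum>d\<in>{q*k..<q*k+q}. \<chi> d) = (\<Sum>d<q. \<chi> (d + q*k))"
      using sum.shift_bounds_nat_ivl[of \<chi> 0 "q*k" q] by (simp add: atLeast0LessThan add.commute)
    also have "\<dots> = (\<Sum>d<q. \<chi> d)" by (intro sum.cong refl cong_eq) (simp add: cong_def)
    finally show ?case using Suc block by simp
  qed simp
  finally show ?thesis .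
qed

lemma abs_le_1: "\<bar>\<chi> d\<bar> \<le> 1"
  using vals[of d] by auto

lemma abs_partial_sum: "\<bar>\<Sum>d\<in>{1..n}. \<chi> d\<bar> \<le> int q"
proof -
  define K where "K = q * (n div q)"
  have K: "K \<le> n" "n < K + q" 
    using dividend_less_times_div[OF q_pos, of n] by (simp_all add: K_def)
  have un: "{1..n} = {1..K} \<union> {K+1..n}" using K by auto
  have "(\<Sum>d\<in>{1..n}. \<chi> d) = (\<Sum>d\<in>{1..K}. \<chi> d) + (\<Sum>d\<in>{K+1..n}. \<chi> d)"
    by (subst un, subst sum.union_disjoint) auto
  also have "\<dots> = (\<Sum>d\<in>{K+1..n}. \<chi> d)" by (simp only: sum_period K_def)
  finally have "\<bar>\<Sum>d\<in>{1..n}. \<chi> d\<bar> \<le> (\<Sum>d\<in>{K+1..n}. \<bar>\<chi> d\<bar>)" by (simp add: sum_abs)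
  also have "\<dots> \<le> (\<Sum>d\<in>{K+1..n}. 1)"
    by (intro sum_mono abs_le_1)
  also have "\<dots> \<le> int q" using K by simp
  finally show ?thesis .
qed

text \<open>Partial sums of the series for L(1, chi).\<close>

definition P :: "nat \<Rightarrow> real" where
  "P n = (\<Sum>d\<in>{1..n}. real_of_int (\<chi> d) / real d)"

text \<open>The Dirichlet convolution of 1 and \<open>\<chi>\<close>, that is, the coefficients of
  zeta(s) L(s, chi) and of the Lambert series of \<open>\<chi>\<close>.\<close>

definition R :: "nat \<Rightarrow> int" where
  "R m = (\<Sum>d | d dvd m. \<chi> d)"

text \<open>Dirichlet's hyperbola method with the cut at a multiple \<open>L\<close> of the modulus: both wings are
  equal, and the square in the middle consists of whole periods.\<close>

lemma P_bound_if_R_vanishes: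
  assumes c0: "\<chi> c0 = 1" and R0: "\<And>c. c > 0 \<Longrightarrow> [c = c0] (mod q) \<Longrightarrow> R c = 0" and k: "k > 0"
  shows "\<bar>P (q * k)\<bar> \<le> 1 / real k"
proof -
  define L where "L = q * k"
  have L: "L > 0" using q_pos k by (simp add: L_def)
  define S where "S = {(d, e). d \<ge> 1 \<and> e \<ge> 1 \<and> d * e \<le> L\<^sup>2 \<and> [d * e = c0] (mod q)}"
  have finS: "finite S"
  proof (rule finite_subset)
    show "S \<subseteq> {..L\<^sup>2} \<times> {..L\<^sup>2}"
    proof (clarsimp simp: S_def)
      fix a b assume "Suc 0 \<le> a" "Suc 0 \<le> b" "a * b \<le> L\<^sup>2"
      moreover have "a * 1 \<le> a * b" "1 * b \<le> a * b" using calculation by (intro mult_le_mono; simp)+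
      ultimately show "a \<le> L\<^sup>2 \<and> b \<le> L\<^sup>2" by linarith
    qed
  qed simp
  let ?f = "\<lambda>(d, e::nat). \<chi> d"
  have sumS: "(\<Sum>p\<in>S. ?f p) = 0"
  proof -
    define C where "C = {c \<in> {1..L\<^sup>2}. [c = c0] (mod q)}"
    have "S = (\<lambda>(c, d). (d, c div d)) ` (SIGMA c:C. {d. d dvd c})"
    proof (intro equalityI subsetI)
      fix p assume "p \<in> S"
      then obtain d e where p: "p = (d, e)" "d \<ge> 1" "e \<ge> 1" "d * e \<le> L\<^sup>2" "[d * e = c0] (mod q)"
        by (auto simp: S_def)
      then show "p \<in> (\<lambda>(c, d). (d, c div d)) ` (SIGMA c:C. {d. d dvd c})"
        by (intro image_eqI[of _ _ "(d * e, d)"]) (auto simp: C_def)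
    next
      fix p assume "p \<in> (\<lambda>(c, d). (d, c div d)) ` (SIGMA c:C. {d. d dvd c})"
      then show "p \<in> S" by (auto simp: S_def C_def elim!: dvdE)
    qed
    moreover have "inj_on (\<lambda>(c, d). (d, c div d)) (SIGMA c:C. {d. d dvd c})"
      by (auto simp: inj_on_def C_def elim!: dvdE)
    ultimately have "(\<Sum>p\<in>S. ?f p) = (\<Sum>(c, d)\<in>(SIGMA c:C. {d. d dvd c}). \<chi> d)"
      by (simp add: sum.reindex case_prod_unfold)
    also have "\<dots> = (\<Sum>c\<in>C. R c)"
      unfolding R_def by (subst sum.Sigma) (auto simp: C_def)
    also have "\<dots> = 0" by (intro sum.neutral) (use R0 in \<open>auto simp: C_def\<close>)
    finally show ?thesis .
  qed
  define S1 where "S1 = {p \<in> S. fst p \<le> L}"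
  define S2 where "S2 = {p \<in> S. snd p \<le> L}"
  have S12: "S = S1 \<union> S2"
  proof -
    have "d \<le> L \<or> e \<le> L" if "d * e \<le> L\<^sup>2" for d e :: nat
    proof (rule ccontr)
      assume "\<not> (d \<le> L \<or> e \<le> L)"
      then have "L * L < d * e" by (intro mult_strict_mono) auto
      then show False using that by (simp add: power2_eq_square)
    qed
    then show ?thesis unfolding S_def S1_def S2_def by fastforce
  qed
  have swap: "(\<Sum>p\<in>S2. ?f p) = (\<Sum>p\<in>S1. ?f p)"
  proof -
    \<comment> \<open>Here \<open>\<chi> c0 = 1\<close> enters: the two factors of a number in the
      class have the same character value, so exchanging them preserves the summand.\<close>
    have "\<chi> d = \<chi> e" if "[d * e = c0] (mod q)" for d e
    proof -
      have "\<chi> d * \<chi> e = 1" using cong_eq[OF that] c0 mult by simp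
      then show ?thesis using vals[of d] vals[of e] by auto
    qed
    then have "(\<Sum>p\<in>S2. ?f p) = (\<Sum>p\<in>S2. \<chi> (snd p))"
      by (intro sum.cong) (auto simp: S2_def S_def)
    also have "\<dots> = (\<Sum>p\<in>S1. ?f p)"
      by (rule sum.reindex_bij_witness[of _ prod.swap prod.swap])
         (auto simp: S1_def S2_def S_def mult.commute)
    finally show ?thesis .
  qed
  \<comment> \<open>For a unit \<open>d\<close> the condition on \<open>e\<close> is a single
    residue class; for every other \<open>d\<close> the weight \<open>\<chi> d\<close> is
    zero.\<close>
  have fiber: "\<exists>r. \<forall>e. [d * e = c0] (mod q) \<longleftrightarrow> [e = r] (mod q)" if cop: "coprime d q" for d
  proof -
    obtain x where x: "[d * x = 1] (mod q)" using cong_solve_coprime_nat[OF cop] by auto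
    have "[d * e = c0] (mod q) \<longleftrightarrow> [e = x * c0] (mod q)" for e
    proof
      assume "[d * e = c0] (mod q)"
      then have "[x * (d * e) = x * c0] (mod q)" by (intro cong_mult) auto
      moreover have "[x * (d * e) = e] (mod q)"
        using cong_mult[OF x cong_refl[of e]] by (simp add: mult_ac)
      ultimately show "[e = x * c0] (mod q)" by (meson cong_sym cong_trans)
    next
      assume "[e = x * c0] (mod q)"
      then have "[d * e = d * (x * c0)] (mod q)" by (intro cong_mult) auto
      moreover have "[d * (x * c0) = c0] (mod q)"
        using cong_mult[OF x cong_refl[of c0]] by (simp add: mult_ac)
      ultimately show "[d * e = c0] (mod q)" by (meson cong_trans)
    qed
    then show ?thesis by blast
  qed
  have le_div: "d * e \<le> L\<^sup>2 \<longleftrightarrow> e \<le> L\<^sup>2 div d" if "d \<ge> 1" for d e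
    using that by (simp add: less_eq_div_iff_mult_less_eq mult.commute)
  have s3: "(\<Sum>p\<in>S1 \<inter> S2. ?f p) = 0"
  proof -
    have "S1 \<inter> S2 = (SIGMA d:{1..L}. {e\<in>{1..L}. [d * e = c0] (mod q)})"
    proof -
      have "d * e \<le> L\<^sup>2" if "d \<le> L" "e \<le> L" for d e
        unfolding power2_eq_square using that by (rule mult_le_mono)
      then show ?thesis by (auto simp: S1_def S2_def S_def)
    qed
    then have "(\<Sum>p\<in>S1 \<inter> S2. ?f p) = (\<Sum>d\<in>{1..L}. \<Sum>e | e\<in>{1..L} \<and> [d * e = c0] (mod q). \<chi> d)"
      by (simp only:, subst sum.Sigma) auto
    also have "\<dots> = (\<Sum>d\<in>{1..L}. int k * \<chi> d)"
    proof (rule sum.cong[OF refl])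
      fix d assume "d \<in> {1..L}"
      show "(\<Sum>e | e\<in>{1..L} \<and> [d * e = c0] (mod q). \<chi> d) = int k * \<chi> d"
      proof (cases "coprime d q")
        case True
        then obtain r where r: "\<And>e. [d * e = c0] (mod q) \<longleftrightarrow> [e = r] (mod q)" using fiber by blast
        have "card {e\<in>{1..L}. [d * e = c0] (mod q)} = k"
          unfolding r L_def by (rule count_cong_class(3)[OF q_pos])
        then show ?thesis by simp
      next
        case False
        then have "\<chi> d = 0" using zero_iff by simp
        then show ?thesis by simp
      qed
    qed
    also have "\<dots> = 0" by (simp add: sum_distrib_left[symmetric] sum_period L_def del: One_nat_def)
    finally show ?thesis .
  qed
  have s1: "(\<Sum>p\<in>S1. ?f p) = (\<Sum>d\<in>{1..L}. \<chi> d * int (card {e\<in>{1..L\<^sup>2 div d}. [d * e = c0] (mod q)}))"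
  proof -
    have "S1 = (SIGMA d:{1..L}. {e\<in>{1..L\<^sup>2 div d}. [d * e = c0] (mod q)})"
      using le_div by (auto simp: S1_def S_def)
    then have "(\<Sum>p\<in>S1. ?f p) = (\<Sum>d\<in>{1..L}. \<Sum>e | e\<in>{1..L\<^sup>2 div d} \<and> [d * e = c0] (mod q). \<chi> d)"
      by (simp only:, subst sum.Sigma) auto
    then show ?thesis by (simp add: mult.commute)
  qed
  have fin12: "finite S1" "finite S2" using finS by (auto simp: S1_def S2_def)
  have "(\<Sum>p\<in>S1. ?f p) + (\<Sum>p\<in>S2. ?f p) = (\<Sum>p\<in>S. ?f p) + (\<Sum>p\<in>S1 \<inter> S2. ?f p)"
    unfolding S12 by (rule sum.union_inter[symmetric, OF fin12])
  then have zero: "(\<Sum>d\<in>{1..L}. \<chi> d * int (card {e\<in>{1..L\<^sup>2 div d}. [d * e = c0] (mod q)})) = 0"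
    using sumS s3 swap s1 by simp
  define N where "N = (\<lambda>d. real (card {e\<in>{1..L\<^sup>2 div d}. [d * e = c0] (mod q)}))"
  have zero': "(\<Sum>d\<in>{1..L}. real_of_int (\<chi> d) * N d) = 0"
    using arg_cong[OF zero, of real_of_int] by (simp add: N_def)
  \<comment> \<open>The number of \<open>e\<close> is L^2 / (d q) with an error of at most 1. Summed
    over \<open>d\<close>, the main term is \<open>P L\<close> times L^2 / q = L k and the error at
    most \<open>L\<close>; hence the bound 1 / k.\<close>
  have near: "\<bar>real_of_int (\<chi> d) * N d - real_of_int (\<chi> d) * ((real L)\<^sup>2 / (real d * real q))\<bar> \<le> 1"
    if "d \<in> {1..L}" for d
  proof (cases "coprime d q")
    case True
    then obtain r where r: "\<And>e. [d * e = c0] (mod q) \<longleftrightarrow> [e = r] (mod q)" using fiber by blast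
    define x where "x = L\<^sup>2 div d"
    have d: "d > 0" using that by simp
    have "d * x \<le> L\<^sup>2" "L\<^sup>2 \<le> d * (x + 1)"
      using dividend_less_times_div[OF d, of "L\<^sup>2"] by (simp_all add: x_def)
    then have "real (d * x) \<le> real (L\<^sup>2)" "real (L\<^sup>2) \<le> real (d * (x + 1))"
      using of_nat_le_iff by blast+
    then have "real x \<le> (real L)\<^sup>2 / real d" "(real L)\<^sup>2 / real d \<le> real (x + 1)"
      using d by (simp_all add: field_simps)
    then have "real x / real q \<le> (real L)\<^sup>2 / real d / real q"
      "(real L)\<^sup>2 / real d / real q \<le> real (x + 1) / real q"
      by - (rule divide_right_mono, assumption, simp)+
    moreover have "N d = real (card {e\<in>{1..x}. [e = r] (mod q)})"
      by (simp add: N_def r x_def)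
    ultimately have "\<bar>N d - (real L)\<^sup>2 / (real d * real q)\<bar> \<le> 1"
      using count_cong_class(1,2)[OF q_pos, of x r] by (simp add: abs_le_iff)
    moreover have "\<bar>real_of_int (\<chi> d)\<bar> \<le> 1"
      using abs_le_1[of d] by linarith
    ultimately have "\<bar>real_of_int (\<chi> d)\<bar> * \<bar>N d - (real L)\<^sup>2 / (real d * real q)\<bar> \<le> 1 * 1"
      by (intro mult_mono) auto
    then show ?thesis by (simp add: abs_mult[symmetric] right_diff_distrib)
  next
    case False
    then have "\<chi> d = 0" using zero_iff by simp
    then show ?thesis by simp
  qed
  have "P L * ((real L)\<^sup>2 / real q) = (\<Sum>d\<in>{1..L}. real_of_int (\<chi> d) * ((real L)\<^sup>2 / (real d * real q)))"
    by (simp add: P_def sum_distrib_right sum_divide_distrib)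
  then have "\<bar>P L * ((real L)\<^sup>2 / real q)\<bar>
      = \<bar>\<Sum>d\<in>{1..L}. real_of_int (\<chi> d) * N d - real_of_int (\<chi> d) * ((real L)\<^sup>2 / (real d * real q))\<bar>"
    using zero' by (simp add: sum_subtractf)
  also have "\<dots> \<le> (\<Sum>d\<in>{1..L}. 1)"
    by (rule order_trans[OF sum_abs], rule sum_mono, rule near)
  also have "\<dots> = real L" by simp
  finally have "\<bar>P L\<bar> * ((real L)\<^sup>2 / real q) \<le> real L"
    by (simp add: abs_mult)
  moreover have "(real L)\<^sup>2 / real q = real L * real k"
    using q_pos by (simp add: L_def power2_eq_square)
  ultimately have "real L * (\<bar>P L\<bar> * real k) \<le> real L * 1"
    by (simp add: mult_ac)
  then have "\<bar>P L\<bar> * real k \<le> 1"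
    using L by (simp only: mult_le_cancel_left_pos of_nat_0_less_iff)
  then show ?thesis
    using k by (simp add: L_def pos_le_divide_eq)
qed

section \<open>Multiplicativity, sign and zeros of \<open>R\<close>\<close>

lemma R_mult:
  assumes "coprime a b" "a > 0" "b > 0"
  shows "R (a * b) = R a * R b"
proof -
  have im: "{d. d dvd a * b} = (\<lambda>(x, y). x * y) ` ({x. x dvd a} \<times> {y. y dvd b})"
  proof (intro equalityI subsetI)
    fix d assume "d \<in> {d. d dvd a * b}"
    then obtain x y where "d = x * y" "x dvd a" "y dvd b" using division_decomp by blast
    then show "d \<in> (\<lambda>(x, y). x * y) ` ({x. x dvd a} \<times> {y. y dvd b})" by auto
  qed (auto intro: mult_dvd_mono)
  have inj: "inj_on (\<lambda>(x, y). x * y) ({x. x dvd a} \<times> {y. y dvd b})"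
  proof (rule inj_onI, clarsimp)
    fix x y x' y' assume *: "x dvd a" "y dvd b" "x' dvd a" "y' dvd b" "x * y = x' * y'"
    have "coprime x y'" "coprime x' y" using * assms(1) coprime_divisors by blast+
    then have "x dvd x'" "x' dvd x"
      using * by (metis coprime_dvd_mult_left_iff dvd_triv_left)+
    then have "x = x'" by (rule dvd_antisym)
    moreover have "x > 0" using * assms(2) dvd_pos_nat by blast
    ultimately show "x = x' \<and> y = y'" using * by simp
  qed
  have "R (a * b) = (\<Sum>(x, y)\<in>{x. x dvd a} \<times> {y. y dvd b}. \<chi> x * \<chi> y)"
    unfolding R_def im by (subst sum.reindex[OF inj]) (simp add: case_prod_unfold mult)
  also have "\<dots> = R a * R b"
    unfolding R_def by (simp add: sum_product sum.cartesian_product)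
  finally show ?thesis .
qed

lemma power: "\<chi> (a ^ k) = \<chi> a ^ k"
  by (induction k) (use one mult in auto)

lemma R_prime_power:
  assumes "prime p"
  shows "R (p ^ k) = (\<Sum>i\<le>k. \<chi> p ^ i)"
proof -
  have "{d. d dvd p ^ k} = (\<lambda>i. p ^ i) ` {..k}"
    using assms by (auto simp: divides_primepow_nat)
  moreover have "inj_on (\<lambda>i. p ^ i) {..k}"
    using prime_power_inj[OF assms] by (auto simp: inj_on_def)
  ultimately show ?thesis by (simp add: R_def sum.reindex power)
qed

lemma sum_minus_one_powers: "(\<Sum>i\<le>k. (-1::int) ^ i) = (if even k then 1 else 0)"
  by (induction k) auto

lemma R_prime_power_cases:
  assumes "prime p"
  shows "R (p ^ k) \<ge> 0" "even k \<Longrightarrow> R (p ^ k) \<ge> 1" "\<chi> p = -1 \<Longrightarrow> odd k \<Longrightarrow> R (p ^ k) = 0"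
proof -
  consider "\<chi> p = 0" | "\<chi> p = 1" | "\<chi> p = -1" using vals[of p] by auto
  then have "R (p ^ k) = (if \<chi> p = 0 then 1 else if \<chi> p = 1 then int k + 1 else if even k then 1 else 0)"
  proof cases
    case 1
    have "(\<Sum>i\<le>k. (0::int) ^ i) = 1" by (induction k) auto
    then show ?thesis using 1 by (simp add: R_prime_power[OF assms])
  qed (use sum_minus_one_powers[of k] in \<open>simp_all add: R_prime_power[OF assms]\<close>)
  then show "R (p ^ k) \<ge> 0" "even k \<Longrightarrow> R (p ^ k) \<ge> 1" "\<chi> p = -1 \<Longrightarrow> odd k \<Longrightarrow> R (p ^ k) = 0"
    by auto
qed

lemma R_1: "R 1 = 1" using one by (simp add: R_def)

lemma R_prime_split:
  fixes m p :: nat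
  assumes "prime p" "m > 0"
  obtains k m' where "m = p ^ k * m'" "k = multiplicity p m" "\<not> p dvd m'" "m' > 0" "R m = R (p ^ k) * R m'"
proof -
  obtain m' where m': "m = p ^ multiplicity p m * m'" "\<not> p dvd m'"
    using multiplicity_decompose'[of m p] assms by (metis not_prime_unit not_gr_zero)
  have "m' > 0" using m'(2) by (cases "m' = 0") auto
  moreover have "coprime (p ^ multiplicity p m) m'" 
    using assms(1) m'(2) by (simp add: prime_imp_coprime)
  moreover have "p ^ multiplicity p m > 0" using assms(1) by (simp add: prime_gt_0_nat)
  ultimately show ?thesis using m' that R_mult by metis
qed

lemma R_nonneg: "m > 0 \<Longrightarrow> R m \<ge> 0"
proof (induction m rule: less_induct)
  case (less m)
  show ?case
  proof (cases "m = 1")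
    case False
    then obtain p where p: "prime p" "p dvd m" using prime_factor_nat by blast
    obtain k m' where *: "m = p ^ k * m'" "k = multiplicity p m" "\<not> p dvd m'" "m' > 0" "R m = R (p ^ k) * R m'"
      using R_prime_split[OF p(1) less.prems] by blast
    have "k \<noteq> 0" using *(1,3) p(2) by (metis mult_1 power_0)
    then have "p ^ k > 1" using prime_gt_1_nat[OF p(1)] by (intro one_less_power) simp_all
    then have "m' < m" using *(1,4) by simp
    then show ?thesis using *(4,5) less.IH R_prime_power_cases(1)[OF p(1)] by simp
  qed (use R_1 in simp)
qed

lemma R_square: "m > 0 \<Longrightarrow> R (m\<^sup>2) \<ge> 1"
proof (induction m rule: less_induct)
  case (less m)
  show ?case
  proof (cases "m = 1")
    case False
    then obtain p where p: "prime p" "p dvd m" using prime_factor_nat by blast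
    obtain k m' where *: "m = p ^ k * m'" "\<not> p dvd m'" "m' > 0"
      using R_prime_split[OF p(1) less.prems] by metis
    have "k \<noteq> 0" using * p(2) by (metis mult_1 power_0)
    then have "p ^ k > 1" using prime_gt_1_nat[OF p(1)] by (intro one_less_power) simp_all
    then have "m' < m" using *(1,3) by simp
    have "m\<^sup>2 = p ^ (2 * k) * m'\<^sup>2"
      by (simp add: *(1) power_mult_distrib power_mult[symmetric] mult.commute)
    moreover have "R (p ^ (2 * k) * m'\<^sup>2) = R (p ^ (2 * k)) * R (m'\<^sup>2)"
      using p(1) *(2,3) by (intro R_mult) (auto simp: prime_imp_coprime prime_gt_0_nat)
    moreover have "R (p ^ (2 * k)) \<ge> 1" by (intro R_prime_power_cases(2) p) simp
    moreover have "R (m'\<^sup>2) \<ge> 1" using less.IH \<open>m' < m\<close> *(3) by blast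
    ultimately have "1 * 1 \<le> R (p ^ (2 * k)) * R (m'\<^sup>2)" by (intro mult_mono) auto
    then show ?thesis
      using \<open>m\<^sup>2 = _\<close> \<open>R (p ^ (2 * k) * m'\<^sup>2) = _\<close> by (simp only: mult_1)
  qed (use R_1 in simp)
qed

text \<open>An odd power of a prime with \<open>\<chi> p = -1\<close> contributes a factor 0, and
  coprimality to \<open>q\<close> excludes \<open>\<chi> p = 0\<close>. So
  \<open>R m \<noteq> 0\<close> controls every prime in the squarefree part of
  \<open>m\<close>.\<close>

lemma R_nonzero_imp:
  assumes "R m \<noteq> 0" "m > 0" "coprime m q" "prime p" "odd (multiplicity p m)"
  shows "\<chi> p = 1"
proof -
  have "multiplicity p m \<noteq> 0" using assms(5) by (intro notI) simp
  then have "p dvd m" using not_dvd_imp_multiplicity_0[of p m] by argo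
  then have "coprime p q" by (rule coprime_divisors[OF _ dvd_refl assms(3)])
  then have "\<chi> p \<noteq> 0" using zero_iff[of p] by blast
  moreover have "\<chi> p \<noteq> -1"
  proof
    assume "\<chi> p = -1"
    obtain k m' where *: "m = p ^ k * m'" "k = multiplicity p m" "\<not> p dvd m'" "m' > 0" "R m = R (p ^ k) * R m'"
      using R_prime_split[OF assms(4,2)] by blast
    have "odd k" using *(2) assms(5) by simp
    from R_prime_power_cases(3)[OF assms(4) \<open>\<chi> p = -1\<close> this] show False
      using *(5) assms(1) by simp
  qed
  ultimately show ?thesis using vals[of p] by auto
qed

text \<open>The Lambert series of \<open>\<chi>\<close>, truncated at \<open>K\<close>. Subtracting the polar part \<open>P K / (1 - t)\<close> leaves
  weights that decrease in \<open>d\<close>, so that Abel summation bounds the rest by the modulus.\<close>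

lemma R_power_series:
  fixes t :: real
  assumes t: "0 < t" "t < 1"
  shows "(\<Sum>m\<in>{1..K}. real_of_int (R m) * t ^ m) \<le> \<bar>P K\<bar> / (1 - t) + real q + real K * t ^ K / (1 - t)"
proof -
  have tpow: "t ^ d < 1" if "d \<ge> 1" for d using t that by (simp add: power_less_one_iff)
  have "(\<Sum>m\<in>{1..K}. real_of_int (R m) * t ^ m) = (\<Sum>(m, d)\<in>(SIGMA m:{1..K}. {d. d dvd m}). real_of_int (\<chi> d) * t ^ m)"
    by (subst sum.Sigma[symmetric]) (auto simp: R_def sum_distrib_right)
  also have "\<dots> = (\<Sum>(d, e)\<in>(SIGMA d:{1..K}. {1..K div d}). real_of_int (\<chi> d) * t ^ (d * e))"
  proof (rule sum.reindex_bij_witness[of _ "\<lambda>(d, e). (d * e, d)" "\<lambda>(m, d). (d, m div d)"])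
    fix p assume "p \<in> (SIGMA m:{1..K}. {d. d dvd m})"
    then obtain m d where p: "p = (m, d)" "m \<ge> 1" "m \<le> K" "d dvd m" by auto
    have "d \<ge> 1" "d \<le> m" using p dvd_pos_nat dvd_imp_le by force+
    then show "(case p of (m, d) \<Rightarrow> (d, m div d)) \<in> (SIGMA d:{1..K}. {1..K div d})"
      using p by (auto simp: div_le_mono div_greater_zero_iff Suc_le_eq)
    show "(case (case p of (m, d) \<Rightarrow> (d, m div d)) of (d, e) \<Rightarrow> (d * e, d)) = p" using p by simp
    show "(case (case p of (m, d) \<Rightarrow> (d, m div d)) of (d, e) \<Rightarrow> real_of_int (\<chi> d) * t ^ (d * e))
        = (case p of (m, d) \<Rightarrow> real_of_int (\<chi> d) * t ^ m)" using p by simp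
  next
    fix p assume "p \<in> (SIGMA d:{1..K}. {1..K div d})"
    then obtain d e where p: "p = (d, e)" "d \<ge> 1" "d \<le> K" "e \<ge> 1" "e \<le> K div d" by auto
    then have "d * e \<le> K" by (simp add: less_eq_div_iff_mult_less_eq mult.commute)
    then show "(case p of (d, e) \<Rightarrow> (d * e, d)) \<in> (SIGMA m:{1..K}. {d. d dvd m})" using p by auto
    show "(case (case p of (d, e) \<Rightarrow> (d * e, d)) of (m, d) \<Rightarrow> (d, m div d)) = p" using p by simp
  qed
  also have "\<dots> = (\<Sum>d\<in>{1..K}. real_of_int (\<chi> d) * (\<Sum>e\<in>{1..K div d}. t ^ (d * e)))"
    by (subst sum.Sigma[symmetric]) (auto simp: sum_distrib_left)
  also have "\<dots> = (\<Sum>d\<in>{1..K}. real_of_int (\<chi> d) * (t ^ d / (1 - t ^ d)) - real_of_int (\<chi> d) * (t ^ (d * (K div d + 1)) / (1 - t ^ d)))"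
  proof (rule sum.cong[OF refl])
    fix d assume d: "d \<in> {1..K}"
    have "1 \<le> K div d" using d by (simp add: div_greater_zero_iff Suc_le_eq)
    then have "(1 - t ^ d) * (\<Sum>e\<in>{1..K div d}. (t ^ d) ^ e) = t ^ d - t ^ d * (t ^ d) ^ (K div d)"
      using sum_gp_multiplied[of 1 "K div d" "t ^ d"] by simp
    then have "(\<Sum>e\<in>{1..K div d}. t ^ (d * e)) * (1 - t ^ d) = t ^ d - t ^ (d * (K div d + 1))"
      by (simp only: power_mult power_add power_one_right mult.commute[of _ "1 - t ^ d"] mult.commute[of _ "t ^ d"])
    then have "(\<Sum>e\<in>{1..K div d}. t ^ (d * e)) = (t ^ d - t ^ (d * (K div d + 1))) / (1 - t ^ d)"
      using tpow[of d] d by (simp add: eq_divide_eq)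
    then show "real_of_int (\<chi> d) * (\<Sum>e\<in>{1..K div d}. t ^ (d * e)) = real_of_int (\<chi> d) * (t ^ d / (1 - t ^ d)) - real_of_int (\<chi> d) * (t ^ (d * (K div d + 1)) / (1 - t ^ d))"
      by (simp add: diff_divide_distrib right_diff_distrib)
  qed
  also have "\<dots> = (\<Sum>d\<in>{1..K}. real_of_int (\<chi> d) * (t ^ d / (1 - t ^ d))) - (\<Sum>d\<in>{1..K}. real_of_int (\<chi> d) * (t ^ (d * (K div d + 1)) / (1 - t ^ d)))"
    by (rule sum_subtractf)
  finally have main: "(\<Sum>m\<in>{1..K}. real_of_int (R m) * t ^ m) = \<dots>" .
  \<comment> \<open>Cutting the geometric series in \<open>e\<close> at \<open>K div d\<close> makes
    the first omitted exponent at least \<open>K\<close> for every \<open>d\<close>, so all the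
    tails obey the same bound.\<close>
  have tail: "\<bar>\<Sum>d\<in>{1..K}. real_of_int (\<chi> d) * (t ^ (d * (K div d + 1)) / (1 - t ^ d))\<bar> \<le> (\<Sum>d\<in>{1..K}. t ^ K / (1 - t))"
  proof (rule order_trans[OF sum_abs], rule sum_mono)
    fix d assume d: "d \<in> {1..K}"
    have "K \<le> d * (K div d + 1)" using dividend_less_times_div[of d K] d by simp
    then have "t ^ (d * (K div d + 1)) \<le> t ^ K" using t by (intro power_decreasing) auto
    moreover have "t ^ d \<le> t ^ 1" using t d by (intro power_decreasing) auto
    ultimately have "t ^ (d * (K div d + 1)) / (1 - t ^ d) \<le> t ^ K / (1 - t)"
      using t by (intro frac_le) auto
    moreover have "0 \<le> t ^ (d * (K div d + 1)) / (1 - t ^ d)" using t tpow[of d] d by simp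
    moreover have "\<bar>real_of_int (\<chi> d)\<bar> \<le> 1" using abs_le_1[of d] by linarith
    ultimately have "\<bar>real_of_int (\<chi> d)\<bar> * \<bar>t ^ (d * (K div d + 1)) / (1 - t ^ d)\<bar> \<le> 1 * (t ^ K / (1 - t))"
      by (intro mult_mono) (simp_all only: abs_of_nonneg abs_ge_zero zero_le_one)
    then show "\<bar>real_of_int (\<chi> d) * (t ^ (d * (K div d + 1)) / (1 - t ^ d))\<bar> \<le> t ^ K / (1 - t)"
      by (simp add: abs_mult)
  qed
  define s where "s = (\<lambda>n. \<Sum>i<n. t ^ i)"
  \<comment> \<open>This is 1 / (d (1 - t)) - t^d / (1 - t^d), in the shape whose monotonicity is
    known. As \<open>b 1 = 1\<close>, the resulting bound does not depend on
    \<open>t\<close>.\<close>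
  define b where "b = (\<lambda>n. (1 / real n - t ^ n / s n) / (1 - t))"
  have geo: "1 - t ^ n = (1 - t) * s n" for n
    unfolding s_def by (rule one_diff_power_eq)
  have b: "t ^ d / (1 - t ^ d) = 1 / real d / (1 - t) - b d" for d
    by (simp add: b_def geo diff_divide_distrib mult.commute)
  have "\<bar>\<Sum>d\<in>{1..K}. real_of_int (\<chi> d) * b d\<bar> \<le> real q * b 1"
  proof (rule abel_bound)
    fix m show "\<bar>\<Sum>d\<in>{1..m}. real_of_int (\<chi> d)\<bar> \<le> real q"
      using abs_partial_sum[of m] by (metis of_int_abs of_int_le_iff of_int_of_nat_eq of_int_sum)
  next
    fix n :: nat assume n: "n > 0"
    show "b (Suc n) \<le> b n" unfolding b_def s_def
      using geometric_defect_decreasing(1)[OF t n] t by (intro divide_right_mono) auto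
    show "b n \<ge> 0" unfolding b_def s_def
      using geometric_defect_decreasing(2)[OF t n] t by (intro divide_nonneg_nonneg) auto
  qed
  moreover have "b 1 = 1" using t by (simp add: b_def s_def)
  moreover have "(\<Sum>d\<in>{1..K}. real_of_int (\<chi> d) * (t ^ d / (1 - t ^ d))) = P K / (1 - t) - (\<Sum>d\<in>{1..K}. real_of_int (\<chi> d) * b d)"
    unfolding b by (simp add: right_diff_distrib sum_subtractf P_def sum_divide_distrib)
  moreover have "P K / (1 - t) \<le> \<bar>P K\<bar> / (1 - t)" using t by (intro divide_right_mono) auto
  ultimately show ?thesis using main tail by (simp add: abs_le_iff)
qed

text \<open>\<open>R\<close> is nonnegative and at least 1 on squares, so its power series dominates an arbitrarily long
  partial sum of \<open>t ^ j\<^sup>2\<close> and is unbounded as \<open>t\<close> tends to 1.\<close>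

lemma P_not_small:
  assumes "\<And>k. k > 0 \<Longrightarrow> \<bar>P (q * k)\<bar> \<le> 1 / real k"
  shows False
proof -
  \<comment> \<open>One square more than the bound \<open>q\<close> allows. The order of limits
    matters: with \<open>t\<close> fixed, growing \<open>K\<close> removes the terms with
    \<open>P K\<close> and \<open>t ^ K\<close>; only then does \<open>t\<close> tend to 1, where
    the sum becomes \<open>J\<close>.\<close>
  define J where "J = q + 1"
  have bound: "(\<Sum>j\<in>{1..J}. t ^ (j\<^sup>2)) \<le> real q" if t: "0 < t" "t < 1" for t :: real
  proof (rule LIMSEQ_le_const)
    have "(\<lambda>k. (1 / real (Suc k)) / (1 - t)) \<longlonglongrightarrow> 0 / (1 - t)"
      by (intro tendsto_divide LIMSEQ_Suc[OF lim_1_over_n] tendsto_const) (use t in auto)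
    moreover have "(\<lambda>k. real (q * Suc k) * t ^ (q * Suc k)) \<longlonglongrightarrow> 0"
    proof -
      have "(\<lambda>n. real n * t ^ n) \<longlonglongrightarrow> 0"
        using powser_times_n_limit_0[of t] t by simp
      moreover have "strict_mono (\<lambda>k. q * Suc k)"
        by (rule strict_monoI) (use q_pos in simp)
      ultimately show ?thesis using LIMSEQ_subseq_LIMSEQ by (fastforce simp: o_def)
    qed
    then have "(\<lambda>k. real (q * Suc k) * t ^ (q * Suc k) / (1 - t)) \<longlonglongrightarrow> 0 / (1 - t)"
      by (intro tendsto_divide tendsto_const) (use t in auto)
    ultimately show "(\<lambda>k. (1 / real (Suc k)) / (1 - t) + real q + real (q * Suc k) * t ^ (q * Suc k) / (1 - t)) \<longlonglongrightarrow> real q"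
      using tendsto_add[OF tendsto_add[OF _ tendsto_const[of "real q"]]] by fastforce
    show "\<exists>N. \<forall>k\<ge>N. (\<Sum>j\<in>{1..J}. t ^ (j\<^sup>2)) \<le> (1 / real (Suc k)) / (1 - t) + real q + real (q * Suc k) * t ^ (q * Suc k) / (1 - t)"
    proof (intro exI allI impI)
      fix k assume k: "k \<ge> J\<^sup>2"
      define K where "K = q * Suc k"
      have K: "J\<^sup>2 \<le> K"
        using k q_pos mult_le_mono[of 1 q "J\<^sup>2" "Suc k"] by (simp add: K_def)
      have "(\<Sum>j\<in>{1..J}. t ^ (j\<^sup>2)) \<le> (\<Sum>j\<in>{1..J}. real_of_int (R (j\<^sup>2)) * t ^ (j\<^sup>2))"
      proof (rule sum_mono)
        fix j assume "j \<in> {1..J}"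
        then have "R (j\<^sup>2) \<ge> 1" by (intro R_square) auto
        then have "real_of_int (R (j\<^sup>2)) \<ge> 1" by simp
        then show "t ^ j\<^sup>2 \<le> real_of_int (R (j\<^sup>2)) * t ^ j\<^sup>2" 
          using mult_right_mono[of 1 "real_of_int (R (j\<^sup>2))" "t ^ j\<^sup>2"] t by simp
      qed
      also have "\<dots> = (\<Sum>m\<in>(\<lambda>j. j\<^sup>2) ` {1..J}. real_of_int (R m) * t ^ m)"
        by (subst sum.reindex) (auto simp: inj_on_def)
      also have "\<dots> \<le> (\<Sum>m\<in>{1..K}. real_of_int (R m) * t ^ m)"
      proof (rule sum_mono2)
        show "(\<lambda>j. j\<^sup>2) ` {1..J} \<subseteq> {1..K}"
        proof (rule image_subsetI)
          fix j assume j: "j \<in> {1..J}"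
          then have "j\<^sup>2 \<le> J\<^sup>2" by (intro power_mono) auto
          then have "j\<^sup>2 \<le> K" using K by (rule order_trans)
          then show "j\<^sup>2 \<in> {1..K}" using j by (simp add: Suc_le_eq)
        qed
      qed (use R_nonneg t in auto)
      also have "\<dots> \<le> \<bar>P K\<bar> / (1 - t) + real q + real K * t ^ K / (1 - t)"
        by (rule R_power_series[OF t])
      also have "\<bar>P K\<bar> / (1 - t) \<le> (1 / real (Suc k)) / (1 - t)"
        using assms[of "Suc k"] t by (intro divide_right_mono) (auto simp: K_def)
      finally show "(\<Sum>j\<in>{1..J}. t ^ (j\<^sup>2)) \<le> (1 / real (Suc k)) / (1 - t) + real q + real (q * Suc k) * t ^ (q * Suc k) / (1 - t)"
        by (simp add: K_def)
    qed
  qed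
  have "((\<lambda>t. \<Sum>j\<in>{1..J}. t ^ (j\<^sup>2)) \<longlongrightarrow> (\<Sum>j\<in>{1..J}. 1 ^ (j\<^sup>2))) (at_left (1::real))"
    by (intro tendsto_intros)
  moreover have "\<forall>\<^sub>F t in at_left (1::real). (\<Sum>j\<in>{1..J}. t ^ (j\<^sup>2)) \<le> real q"
    using eventually_at_left_real[of 0 1] by (rule eventually_mono) (use bound in auto)
  ultimately have "(\<Sum>j\<in>{1..J}. 1 ^ (j\<^sup>2)) \<le> real q"
    by (intro tendsto_upperbound) auto
  then show False by (simp add: J_def)
qed

theorem R_nonzero_in_class:
  assumes "\<chi> c0 = 1"
  obtains c where "c > 0" "[c = c0] (mod q)" "R c \<noteq> 0"
  using P_not_small P_bound_if_R_vanishes[OF assms] by blast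

end

section \<open>Jacobi symbols\<close>

lemma Legendre_cong:
  assumes "[a = b] (mod p)"
  shows "Legendre a p = Legendre b p"
proof -
  have "[a = c] (mod p) \<longleftrightarrow> [b = c] (mod p)" for c
    using assms by (meson cong_sym cong_trans)
  moreover have "[c = a] (mod p) \<longleftrightarrow> [c = b] (mod p)" for c
    using assms by (meson cong_sym cong_trans)
  ultimately show ?thesis by (simp add: Legendre_def QuadRes_def)
qed

lemma Legendre_values: "Legendre a p \<in> {-1, 0, 1}"
  by (simp add: Legendre_def)

lemma Legendre_eq_0_iff: "Legendre a p = 0 \<longleftrightarrow> p dvd a"
  by (simp add: Legendre_def cong_0_iff)

text \<open>Euler's criterion gives identities between symbols only modulo \<open>p\<close>; since
  -1, 0 and 1 are distinct modulo \<open>p > 2\<close>, they lift to equalities.\<close>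

lemma sign_cong_imp_eq:
  fixes p x y :: int
  assumes "p > 2" "x \<in> {-1, 0, 1}" "y \<in> {-1, 0, 1}" "[x = y] (mod p)"
  shows "x = y"
proof -
  have "p dvd x - y" using assms(4) by (simp add: cong_iff_dvd_diff)
  moreover have "\<bar>x - y\<bar> < p" using assms by auto
  ultimately show ?thesis using zdvd_not_zless[of "\<bar>x - y\<bar>" p] by (cases "x = y") auto
qed

lemma Legendre_mult:
  assumes "prime p" "p > 2"
  shows "Legendre (a * b) (int p) = Legendre a (int p) * Legendre b (int p)"
proof (rule sign_cong_imp_eq)
  show "int p > 2" using assms by simp
  show "Legendre (a * b) (int p) \<in> {-1, 0, 1}" by (rule Legendre_values)
  show "Legendre a (int p) * Legendre b (int p) \<in> {-1, 0, 1}"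
    using Legendre_values[of a p] Legendre_values[of b p] by auto
  have "[Legendre (a * b) (int p) = (a * b) ^ ((p - 1) div 2)] (mod int p)"
    using euler_criterion[OF assms] by simp
  also have "(a * b) ^ ((p - 1) div 2) = a ^ ((p - 1) div 2) * b ^ ((p - 1) div 2)"
    by (rule power_mult_distrib)
  also have "[\<dots> = Legendre a (int p) * Legendre b (int p)] (mod int p)"
    using euler_criterion[OF assms] by (intro cong_mult) (simp_all add: cong_sym)
  finally show "[Legendre (a * b) (int p) = Legendre a (int p) * Legendre b (int p)] (mod int p)" .
qed

text \<open>The nonprincipal character modulo 4. At an odd prime it is the Legendre symbol of -1 and
  the base of the sign in quadratic reciprocity.\<close>

definition \<chi>4 :: "nat \<Rightarrow> int" where
  "\<chi>4 m = (if m mod 4 = 1 then 1 else if m mod 4 = 3 then - 1 else 0)"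

lemma \<chi>4_mult: "\<chi>4 (a * b) = \<chi>4 a * \<chi>4 b"
proof -
  have \<chi>4_mod: "\<chi>4 m = \<chi>4 (m mod 4)" for m by (simp add: \<chi>4_def)
  have "a mod 4 \<in> {0, 1, 2, 3}" "b mod 4 \<in> {0, 1, 2, 3}" by auto
  then have "\<chi>4 ((a mod 4) * (b mod 4)) = \<chi>4 (a mod 4) * \<chi>4 (b mod 4)"
    by (elim insertE emptyE) (simp_all add: \<chi>4_def)
  moreover have "\<chi>4 (a * b) = \<chi>4 ((a mod 4) * (b mod 4))"
    by (subst (1 2) \<chi>4_mod) (simp add: mod_mult_eq)
  ultimately show ?thesis by (metis \<chi>4_mod)
qed

lemma \<chi>4_eq_power: "odd m \<Longrightarrow> \<chi>4 m = (-1) ^ ((m - 1) div 2)"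
proof -
  assume "odd m"
  then obtain k where "m = 2 * k + 1" by (elim oddE)
  then show ?thesis by (cases "even k") (auto simp: \<chi>4_def elim!: evenE oddE)
qed

lemma Legendre_minus_1:
  assumes "prime p" "p > 2"
  shows "Legendre (-1) (int p) = \<chi>4 p"
proof (rule sign_cong_imp_eq)
  show "[Legendre (-1) (int p) = \<chi>4 p] (mod int p)"
    using euler_criterion[OF assms, of "-1"] \<chi>4_eq_power[OF prime_odd_nat[OF assms]] by simp
  show "int p > 2" using assms by simp
  show "Legendre (-1) (int p) \<in> {-1, 0, 1}" by (rule Legendre_values)
  show "\<chi>4 p \<in> {-1, 0, 1}" by (simp add: \<chi>4_def)
qed

definition Jacobi :: "int \<Rightarrow> nat \<Rightarrow> int" where
  "Jacobi m n = (\<Prod>p\<in>#prime_factorization n. Legendre m (int p))"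

context
  fixes n :: nat
  assumes n: "odd n"
begin

lemma odd_prime_factor: "p \<in># prime_factorization n \<Longrightarrow> prime p \<and> p > 2"
  using n prime_ge_2_nat[of p]
  by (auto simp: in_prime_factors_iff) (metis dvd_trans le_neq_implies_less)

lemma Jacobi_mult: "Jacobi (a * b) n = Jacobi a n * Jacobi b n"
proof -
  have "(\<Prod>p\<in>#prime_factorization n. Legendre (a * b) (int p))
      = (\<Prod>p\<in>#prime_factorization n. Legendre a (int p) * Legendre b (int p))"
    by (rule arg_cong[where f = prod_mset], rule image_mset_cong) (use odd_prime_factor Legendre_mult in blast)
  then show ?thesis by (simp add: Jacobi_def prod_mset.distrib)
qed

lemma Jacobi_cong: "[a = b] (mod int n) \<Longrightarrow> Jacobi a n = Jacobi b n"
  unfolding Jacobi_def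
  by (rule arg_cong[where f = prod_mset], rule image_mset_cong)
     (auto intro!: Legendre_cong elim!: cong_dvd_modulus simp: in_prime_factors_iff)

lemma Jacobi_values: "Jacobi a n \<in> {-1, 0, 1}"
proof -
  have "(\<Prod>p\<in>#M. Legendre a (int p)) \<in> {-1, 0, 1}" for M
  proof (induction M)
    case (add x M)
    then show ?case using Legendre_values[of a x] by auto
  qed simp
  then show ?thesis by (simp add: Jacobi_def)
qed

lemma Jacobi_eq_0_iff: "Jacobi (int m) n = 0 \<longleftrightarrow> \<not> coprime m n"
proof -
  have "n \<noteq> 0" using n by (cases "n = 0") auto
  have "Jacobi (int m) n = 0 \<longleftrightarrow> 0 \<in># image_mset (\<lambda>p. Legendre (int m) (int p)) (prime_factorization n)"
    unfolding Jacobi_def by (rule prod_mset_zero_iff)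
  also have "\<dots> \<longleftrightarrow> (\<exists>p\<in>#prime_factorization n. Legendre (int m) (int p) = 0)" 
    unfolding set_image_mset by force
  also have "\<dots> \<longleftrightarrow> (\<exists>p\<in>#prime_factorization n. p dvd m)"
    by (simp add: Legendre_eq_0_iff)
  also have "\<dots> \<longleftrightarrow> (\<exists>p. prime p \<and> p dvd gcd m n)"
    using \<open>n \<noteq> 0\<close> by (auto simp: in_prime_factors_iff)
  also have "\<dots> \<longleftrightarrow> \<not> coprime m n"
  proof
    assume "\<exists>p. prime p \<and> p dvd gcd m n"
    then obtain p where "prime p" "p dvd gcd m n" by blast
    then have "gcd m n \<noteq> 1" by (intro notI) simp
    then show "\<not> coprime m n" unfolding coprime_iff_gcd_eq_1 .
  next
    assume "\<not> coprime m n"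
    then have "gcd m n \<noteq> 1" unfolding coprime_iff_gcd_eq_1 .
    then show "\<exists>p. prime p \<and> p dvd gcd m n" using prime_factor_nat by blast
  qed
  finally show ?thesis .
qed

lemma \<chi>4_prod: "\<chi>4 n = (\<Prod>p\<in>#prime_factorization n. \<chi>4 p)"
proof -
  have "\<chi>4 (prod_mset M) = (\<Prod>p\<in>#M. \<chi>4 p)" for M
    by (induction M) (simp_all add: \<chi>4_mult, simp add: \<chi>4_def)
  from this[of "prime_factorization n"] show ?thesis
    using n by (cases "n = 0") (simp_all add: prod_mset_prime_factorization_nat)
qed

lemma Jacobi_minus_1: "Jacobi (-1) n = \<chi>4 n"
  unfolding Jacobi_def \<chi>4_prod
  by (rule arg_cong[where f = prod_mset], rule image_mset_cong) (use odd_prime_factor Legendre_minus_1 in blast)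

text \<open>Quadratic reciprocity, with the sign \<open>(-1)^((p-1)/2 * (l-1)/2)\<close> written as a power of \<open>\<chi>4 p\<close>.\<close>

lemma Legendre_eq_Jacobi:
  assumes "prime l" "l > 2" "\<not> l dvd n"
  shows "Legendre (int n) (int l) = \<chi>4 n ^ ((l - 1) div 2) * Jacobi (int l) n"
proof -
  have "Legendre (int (prod_mset M)) (int l)
      = (\<Prod>p\<in>#M. \<chi>4 p) ^ ((l - 1) div 2) * (\<Prod>p\<in>#M. Legendre (int l) (int p))"
    if "\<forall>p\<in>#M. prime p \<and> p > 2 \<and> p \<noteq> l" for M
    using that
  proof (induction M)
    case empty
    have "Legendre 1 (int l) = 1" using assms(2) 
      by (auto simp: Legendre_def QuadRes_def cong_0_iff intro!: exI[of _ 1])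
    then show ?case by simp
  next
    case (add p M)
    have p: "prime p" "p > 2" "p \<noteq> l" using add.prems by auto
    have rec: "Legendre (int p) (int l) * Legendre (int l) (int p) = (- 1) ^ ((p - 1) div 2 * ((l - 1) div 2))"
      using Quadratic_Reciprocity[OF p(1,2) assms(1,2) p(3)] by simp
    have "Legendre (int l) (int p) * Legendre (int l) (int p) = 1"
    proof -
      have "\<not> int p dvd int l" using p assms(1) by (auto simp: primes_dvd_imp_eq)
      then have "Legendre (int l) (int p) \<noteq> 0" by (simp add: Legendre_eq_0_iff)
      then show ?thesis using Legendre_values[of "int l" "int p"] by auto
    qed
    then have "Legendre (int p) (int l) = (- 1) ^ ((p - 1) div 2 * ((l - 1) div 2)) * Legendre (int l) (int p)"
      using rec by (metis mult.assoc mult.right_neutral)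
    also have "(- 1) ^ ((p - 1) div 2 * ((l - 1) div 2)) = \<chi>4 p ^ ((l - 1) div 2)"
      using \<chi>4_eq_power[OF prime_odd_nat[OF p(1,2)]] by (simp add: power_mult)
    finally have "Legendre (int p) (int l) = \<chi>4 p ^ ((l - 1) div 2) * Legendre (int l) (int p)" .
    then show ?case
      using add by (simp add: Legendre_mult[OF assms(1,2)] power_mult_distrib mult_ac)
  qed
  moreover have "\<forall>p\<in>#prime_factorization n. prime p \<and> p > 2 \<and> p \<noteq> l"
    using odd_prime_factor assms(3) by (auto simp: in_prime_factors_iff)
  moreover have "prod_mset (prime_factorization n) = n"
    using n by (intro prod_mset_prime_factorization_nat) (auto intro: ccontr)
  ultimately show ?thesis
    unfolding \<chi>4_prod Jacobi_def by metis
qed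

end

section \<open>Sums of three squares\<close>

text \<open>The quadratic form with Gram matrix (a b c; b d e; c e f).\<close>

definition ternary :: "int \<Rightarrow> int \<Rightarrow> int \<Rightarrow> int \<Rightarrow> int \<Rightarrow> int \<Rightarrow> int \<Rightarrow> int \<Rightarrow> int \<Rightarrow> int" where
  "ternary a b c d e f x y z = a * x\<^sup>2 + 2 * b * x * y + 2 * c * x * z + d * y\<^sup>2 + 2 * e * y * z + f * z\<^sup>2"

lemma nearest_multiple:
  fixes a b :: int
  assumes "a > 0"
  obtains t where "2 * \<bar>b + a * t\<bar> \<le> a"
proof -
  define t where "t = - ((2 * b + a) div (2 * a))"
  define r where "r = (2 * b + a) mod (2 * a)"
  have "0 \<le> r" "r < 2 * a" using assms by (simp_all add: r_def)
  moreover have "2 * (b + a * t) = r - a"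
    using div_mult_mod_eq[of "2 * b + a" "2 * a"] by (simp add: t_def r_def algebra_simps)
  ultimately have "2 * \<bar>b + a * t\<bar> \<le> a" by linarith
  then show ?thesis by (rule that)
qed

text \<open>Gauss reduction. A translation gives \<open>2 * \<bar>Q'\<bar> \<le> P\<close>. If then
  \<open>S' < P\<close>, exchanging the outer coefficients lowers \<open>P\<close>. Otherwise P^2 <=
  P S' = D + Q'^2 <= D + P^2 / 4 with the determinant D, which is the bound.\<close>

lemma binary_reduction:
  fixes P Q S :: int
  assumes "P > 0" "P * S - Q\<^sup>2 > 0"
  shows "\<exists>\<alpha> \<beta> \<gamma> \<delta>. \<alpha> * \<delta> - \<beta> * \<gamma> = 1 \<and> 0 < P * \<alpha>\<^sup>2 + 2 * Q * \<alpha> * \<gamma> + S * \<gamma>\<^sup>2 \<and>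
    3 * (P * \<alpha>\<^sup>2 + 2 * Q * \<alpha> * \<gamma> + S * \<gamma>\<^sup>2)\<^sup>2 \<le> 4 * (P * S - Q\<^sup>2)"
  using assms
proof (induction "nat P" arbitrary: P Q S rule: less_induct)
  case less
  obtain t where t: "2 * \<bar>Q + P * t\<bar> \<le> P" using nearest_multiple[OF less.prems(1)] .
  define Q' where "Q' = Q + P * t"
  define S' where "S' = P * t\<^sup>2 + 2 * Q * t + S"
  have disc: "P * S' - Q'\<^sup>2 = P * S - Q\<^sup>2"
    by (simp add: Q'_def S'_def algebra_simps power2_eq_square)
  have "S' > 0"
  proof -
    have "P * S' > 0" using disc less.prems(2) zero_le_power2[of Q'] by linarith
    then show ?thesis using less.prems(1) by (simp add: zero_less_mult_iff)
  qed
  show ?case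
  proof (cases "S' < P")
    case True
    have disc': "S' * P - (- Q')\<^sup>2 = P * S - Q\<^sup>2" using disc by (simp add: mult.commute)
    have "nat S' < nat P" using True \<open>S' > 0\<close> by simp
    from less.hyps[OF this \<open>S' > 0\<close>, of P "- Q'"] disc' less.prems(2)
    obtain \<alpha> \<beta> \<gamma> \<delta> where *: "\<alpha> * \<delta> - \<beta> * \<gamma> = 1"
      "0 < S' * \<alpha>\<^sup>2 + 2 * (- Q') * \<alpha> * \<gamma> + P * \<gamma>\<^sup>2"
      "3 * (S' * \<alpha>\<^sup>2 + 2 * (- Q') * \<alpha> * \<gamma> + P * \<gamma>\<^sup>2)\<^sup>2 \<le> 4 * (P * S - Q\<^sup>2)"
      by auto
    \<comment> \<open>The substitution composes the translation by \<open>t\<close> with the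
      rotation (x, y) -> (-y, x), whose sign keeps the determinant 1.\<close>
    have "P * (t * \<alpha> - \<gamma>)\<^sup>2 + 2 * Q * (t * \<alpha> - \<gamma>) * \<alpha> + S * \<alpha>\<^sup>2
        = S' * \<alpha>\<^sup>2 + 2 * (- Q') * \<alpha> * \<gamma> + P * \<gamma>\<^sup>2"
      by (simp add: Q'_def S'_def algebra_simps power2_eq_square)
    moreover have "(t * \<alpha> - \<gamma>) * \<beta> - (t * \<beta> - \<delta>) * \<alpha> = 1"
      using *(1) by (simp add: algebra_simps)
    ultimately show ?thesis
      using *(2,3) by (intro exI[of _ "t * \<alpha> - \<gamma>"] exI[of _ "t * \<beta> - \<delta>"] exI[of _ \<alpha>] exI[of _ \<beta>]) simp
  next
    case False
    have "P * P \<le> P * S'" using False less.prems(1) by simp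
    moreover have "4 * Q'\<^sup>2 \<le> P\<^sup>2"
    proof -
      have "(2 * \<bar>Q'\<bar>)\<^sup>2 \<le> P\<^sup>2" using t by (intro power_mono) (auto simp: Q'_def)
      then show ?thesis by (simp add: power_mult_distrib)
    qed
    ultimately have "3 * P\<^sup>2 \<le> 4 * (P * S - Q\<^sup>2)"
      using disc by (simp add: power2_eq_square)
    then show ?thesis
      using less.prems(1) by (intro exI[of _ 1] exI[of _ 0] exI[of _ 0] exI[of _ 1]) simp
  qed
qed

text \<open>Hermite reduction: one round of the descent on the leading coefficient.\<close>

lemma ternary_unimodular_sum3sq:
  fixes a b c d e f :: int
  assumes "a > 0" "a * d - b\<^sup>2 > 0"
    and det: "a * (d * f - e\<^sup>2) - b * (b * f - c * e) + c * (b * e - c * d) = 1"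
  shows "\<exists>p q r. ternary a b c d e f x y z = p\<^sup>2 + q\<^sup>2 + r\<^sup>2"
  using assms
proof (induction "nat a" arbitrary: a b c d e f x y z rule: less_induct)
  case less
  \<comment> \<open>Completing the square: \<open>a\<close> times the form equals \<open>(a * x + b
    * y + c * z)\<^sup>2 + P * y\<^sup>2 + 2 * Q * y * z + S * z\<^sup>2\<close>. The binary part
    has determinant \<open>a\<close> because the ternary form has determinant 1.\<close>
  define P Q S where "P = a * d - b\<^sup>2" and "Q = a * e - b * c" and "S = a * f - c\<^sup>2"
  have PS: "P * S - Q\<^sup>2 = a"
  proof -
    have "P * S - Q\<^sup>2 = a * (a * (d * f - e\<^sup>2) - b * (b * f - c * e) + c * (b * e - c * d))"
      by (simp add: P_def Q_def S_def algebra_simps power2_eq_square)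
    then show ?thesis using less.prems(3) by simp
  qed
  have "P > 0" using less.prems(2) by (simp add: P_def)
  obtain \<alpha> \<beta> \<gamma> \<delta> where uni: "\<alpha> * \<delta> - \<beta> * \<gamma> = 1"
    and P': "0 < P * \<alpha>\<^sup>2 + 2 * Q * \<alpha> * \<gamma> + S * \<gamma>\<^sup>2"
      "3 * (P * \<alpha>\<^sup>2 + 2 * Q * \<alpha> * \<gamma> + S * \<gamma>\<^sup>2)\<^sup>2 \<le> 4 * a"
    using binary_reduction[OF \<open>P > 0\<close>, of S Q] PS less.prems(1) by auto
  define P' where "P' = P * \<alpha>\<^sup>2 + 2 * Q * \<alpha> * \<gamma> + S * \<gamma>\<^sup>2"
  define y' z' where "y' = \<delta> * y - \<beta> * z" and "z' = \<alpha> * z - \<gamma> * y"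
  have yz: "y = \<alpha> * y' + \<beta> * z'" "z = \<gamma> * y' + \<delta> * z'"
  proof -
    have "\<alpha> * y' + \<beta> * z' = (\<alpha> * \<delta> - \<beta> * \<gamma>) * y" "\<gamma> * y' + \<delta> * z' = (\<alpha> * \<delta> - \<beta> * \<gamma>) * z"
      by (simp_all add: y'_def z'_def algebra_simps)
    then show "y = \<alpha> * y' + \<beta> * z'" "z = \<gamma> * y' + \<delta> * z'" by (simp_all add: uni)
  qed
  show ?case
  proof (cases "a = 1")
    case True
    \<comment> \<open>For \<open>a = 1\<close> the reduced binary part has determinant 1 and leading
      coefficient 1, so it is a sum of two squares.\<close>
    have "P' = 1"
    proof -
      have "P'\<^sup>2 \<le> 1" using P'(2) True by (simp add: P'_def)
      then have "P' \<le> 1" by (metis power2_le_imp_le one_power2 zero_le_one)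
      then show ?thesis using P'(1) by (simp add: P'_def)
    qed
    define Q' S' where "Q' = P * \<alpha> * \<beta> + Q * (\<alpha> * \<delta> + \<beta> * \<gamma>) + S * \<gamma> * \<delta>"
      and "S' = P * \<beta>\<^sup>2 + 2 * Q * \<beta> * \<delta> + S * \<delta>\<^sup>2"
    have "P' * S' - Q'\<^sup>2 = (P * S - Q\<^sup>2) * (\<alpha> * \<delta> - \<beta> * \<gamma>)\<^sup>2"
      by (simp add: P'_def Q'_def S'_def algebra_simps power2_eq_square)
    then have S': "S' = Q'\<^sup>2 + 1" using uni PS True \<open>P' = 1\<close> by simp
    have "ternary a b c d e f x y z = (x + b * y + c * z)\<^sup>2 + (P * y\<^sup>2 + 2 * Q * y * z + S * z\<^sup>2)"
      using True by (simp add: ternary_def P_def Q_def S_def algebra_simps power2_eq_square)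
    also have "P * y\<^sup>2 + 2 * Q * y * z + S * z\<^sup>2 = P' * y'\<^sup>2 + 2 * Q' * y' * z' + S' * z'\<^sup>2"
      unfolding yz P'_def Q'_def S'_def by (simp add: algebra_simps power2_eq_square)
    also have "\<dots> = (y' + Q' * z')\<^sup>2 + z'\<^sup>2"
      by (simp add: S' \<open>P' = 1\<close> algebra_simps power2_eq_square)
    finally show ?thesis by (metis add.assoc)
  next
    case False
    \<comment> \<open>Reduce the binary part in \<open>y\<close> and \<open>z\<close>, shift
      \<open>x\<close> by a multiple of \<open>y'\<close> to make \<open>b2\<close> at most half of
      \<open>a\<close>, and exchange the first two variables. The new leading coefficient is
      \<open>d2\<close>, and \<open>P'\<close> is the minor
      \<open>a * d2 - b2\<^sup>2\<close>.\<close>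
    define b1 c1 d1 e1 f1 where "b1 = b * \<alpha> + c * \<gamma>" and "c1 = b * \<beta> + c * \<delta>"
      and "d1 = d * \<alpha>\<^sup>2 + 2 * e * \<alpha> * \<gamma> + f * \<gamma>\<^sup>2"
      and "e1 = d * \<alpha> * \<beta> + e * (\<alpha> * \<delta> + \<beta> * \<gamma>) + f * \<gamma> * \<delta>"
      and "f1 = d * \<beta>\<^sup>2 + 2 * e * \<beta> * \<delta> + f * \<delta>\<^sup>2"
    obtain t where t: "2 * \<bar>b1 + a * t\<bar> \<le> a" using nearest_multiple[OF less.prems(1)] .
    define b2 d2 e2 x' where "b2 = b1 + a * t" and "d2 = d1 + 2 * b1 * t + a * t\<^sup>2"
      and "e2 = e1 + c1 * t" and "x' = x - t * y'"
    have Peq: "a * d2 - b2\<^sup>2 = P'"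
      by (simp add: b2_def d2_def b1_def d1_def P'_def P_def Q_def S_def algebra_simps power2_eq_square)
    have "ternary a b c d e f (x' + t * y') (\<alpha> * y' + \<beta> * z') (\<gamma> * y' + \<delta> * z')
        = ternary d2 b2 e2 a c1 f1 y' x' z'"
      unfolding ternary_def b2_def d2_def e2_def b1_def c1_def d1_def e1_def f1_def
      by (simp add: algebra_simps power2_eq_square)
    then have val: "ternary a b c d e f x y z = ternary d2 b2 e2 a c1 f1 y' x' z'"
      by (simp add: yz[symmetric] x'_def)
    have det1: "a * (d1 * f1 - e1\<^sup>2) - b1 * (b1 * f1 - c1 * e1) + c1 * (b1 * e1 - c1 * d1)
        = (a * (d * f - e\<^sup>2) - b * (b * f - c * e) + c * (b * e - c * d)) * (\<alpha> * \<delta> - \<beta> * \<gamma>)\<^sup>2"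
      by (simp add: b1_def c1_def d1_def e1_def f1_def algebra_simps power2_eq_square)
    have det2: "d2 * (a * f1 - c1\<^sup>2) - b2 * (b2 * f1 - e2 * c1) + e2 * (b2 * c1 - e2 * a) = 1"
    proof -
      have "d2 * (a * f1 - c1\<^sup>2) - b2 * (b2 * f1 - e2 * c1) + e2 * (b2 * c1 - e2 * a)
          = a * (d1 * f1 - e1\<^sup>2) - b1 * (b1 * f1 - c1 * e1) + c1 * (b1 * e1 - c1 * d1)"
        by (simp add: b2_def d2_def e2_def algebra_simps power2_eq_square)
      then show ?thesis using det1 uni less.prems(3) by simp
    qed
    have "a * d2 > 0" using Peq P'(1)[folded P'_def] zero_le_power2[of b2] by linarith
    then have "d2 > 0" using less.prems(1) by (simp add: zero_less_mult_iff)
    \<comment> \<open>Otherwise a^2 <= a d2 = P' + b2^2 <= P' + a^2 / 4. Together with 3 P'^2 <= 4 a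
      this forces 27 a^3 <= 64, impossible for \<open>a\<close> at least 2.\<close>
    have "d2 < a"
    proof (rule ccontr)
      assume "\<not> d2 < a"
      then have "a * a \<le> a * d2" using less.prems(1) by simp
      moreover have "4 * b2\<^sup>2 \<le> a\<^sup>2"
      proof -
        have "(2 * \<bar>b2\<bar>)\<^sup>2 \<le> a\<^sup>2" using t by (intro power_mono) (auto simp: b2_def)
        then show ?thesis by (simp add: power_mult_distrib)
      qed
      ultimately have "3 * a\<^sup>2 \<le> 4 * P'" using Peq by (simp add: power2_eq_square)
      then have "(3 * a\<^sup>2)\<^sup>2 \<le> (4 * P')\<^sup>2" by (intro power_mono) auto
      then have "27 * a ^ 4 \<le> 16 * (3 * P'\<^sup>2)" by (simp add: power_mult_distrib)
      also have "\<dots> \<le> 64 * a" using P'(2) by (simp add: P'_def)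
      finally have "27 * a ^ 3 * a \<le> 64 * a" by (simp add: power_numeral_reduce algebra_simps)
      then have "27 * a ^ 3 \<le> 64" using less.prems(1) by (simp only: mult_le_cancel_right_pos)
      moreover have "2 ^ 3 \<le> a ^ 3" using False less.prems(1) by (intro power_mono) auto
      ultimately show False by simp
    qed
    then have "nat d2 < nat a" using \<open>d2 > 0\<close> by simp
    moreover have "d2 * a - b2\<^sup>2 > 0" using Peq P'(1) by (simp add: P'_def mult.commute)
    ultimately show ?thesis
      unfolding val using less.hyps[OF _ \<open>d2 > 0\<close> _ det2] by blast
  qed
qed

section \<open>Square roots modulo squarefree numbers and the character attached to - n\<close>

lemma squarefree_sqrt_mod:
  fixes C :: nat and a :: int
  assumes "squarefree C" "\<And>p. prime p \<Longrightarrow> p dvd C \<Longrightarrow> \<exists>x. int p dvd x\<^sup>2 - a"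
  shows "\<exists>x. int C dvd x\<^sup>2 - a"
  using assms
proof (induction C rule: less_induct)
  case (less C)
  show ?case
  proof (cases "C = 1")
    case False
    then obtain p where p: "prime p" "p dvd C" using prime_factor_nat by blast
    then obtain D where D: "C = p * D" by (elim dvdE)
    have "C > 0" using less.prems(1) by (intro Nat.gr0I) auto
    then have "D < C" using D p(1) prime_gt_1_nat[of p] by (cases "D = 0") auto
    have "coprime p D"
    proof (rule prime_imp_coprime[OF p(1)])
      show "\<not> p dvd D"
      proof
        assume "p dvd D"
        then have "p\<^sup>2 dvd C" unfolding D power2_eq_square by (rule mult_dvd_mono[OF dvd_refl])
        then have "p dvd 1" using less.prems(1) squarefreeD by blast
        then show False using p(1) by simp
      qed
    qed
    obtain x1 where x1: "int p dvd x1\<^sup>2 - a" using less.prems(2)[OF p] by blast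
    have "squarefree D" using less.prems(1) D squarefree_mono dvd_triv_right by metis
    moreover have "\<exists>x. int l dvd x\<^sup>2 - a" if "prime l" "l dvd D" for l
      using less.prems(2)[OF that(1)] that(2) by (simp add: D)
    ultimately obtain x2 where x2: "int D dvd x2\<^sup>2 - a"
      using less.IH[OF \<open>D < C\<close>] by blast
    obtain x where x: "[x = x1] (mod int p)" "[x = x2] (mod int D)"
      using binary_chinese_remainder_int[of "int p" "int D" x1 x2] \<open>coprime p D\<close> by auto
    have "[x\<^sup>2 - a = x1\<^sup>2 - a] (mod int p)" "[x\<^sup>2 - a = x2\<^sup>2 - a] (mod int D)"
      using x by (auto intro: cong_diff cong_pow)
    then have "int p dvd x\<^sup>2 - a" "int D dvd x\<^sup>2 - a"
      using x1 x2 by (auto simp: cong_dvd_iff)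
    then have "int C dvd x\<^sup>2 - a"
      unfolding D of_nat_mult using \<open>coprime p D\<close> by (intro divides_mult) auto
    then show ?thesis by blast
  qed auto
qed

text \<open>By reciprocity this is, at odd primes not dividing \<open>n\<close>, the Legendre symbol
  of \<open>- n\<close>; with \<open>n\<close> as the lower argument, periodicity modulo
  \<open>4 * n\<close> is visible. The factor \<open>\<chi>4\<close> makes it nonprincipal even when
  \<open>n\<close> is a square: \<open>1 + 2 * n\<close> is 1 modulo \<open>n\<close> but 3 modulo
  4.\<close>

lemma real_char_Jacobi:
  assumes "n mod 4 = 1"
  shows "real_char (4 * n) (\<lambda>m. \<chi>4 m * Jacobi (int m) n)"
proof
  have n: "odd n" using assms by presburger
  show "4 * n > 0" using n by (cases n) auto
  have Legendre_1: "Legendre 1 (int p) = 1" if "p > 2" for p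
    using that by (auto simp: Legendre_def QuadRes_def cong_0_iff intro!: exI[of _ 1])
  have Jacobi_1: "Jacobi 1 n = 1"
  proof -
    have "(\<Prod>p\<in>#prime_factorization n. Legendre 1 (int p)) = (\<Prod>p\<in>#prime_factorization n. 1)"
      by (rule arg_cong[where f = prod_mset], rule image_mset_cong) (use odd_prime_factor[OF n] Legendre_1 in blast)
    then show ?thesis by (simp add: Jacobi_def)
  qed
  then show "\<chi>4 1 * Jacobi (int 1) n = 1" by (simp add: \<chi>4_def)
  fix a b
  show "\<chi>4 (a * b) * Jacobi (int (a * b)) n = \<chi>4 a * Jacobi (int a) n * (\<chi>4 b * Jacobi (int b) n)"
    by (simp add: \<chi>4_mult Jacobi_mult[OF n])
  have "\<chi>4 (a + 4 * n) = \<chi>4 a" by (simp add: \<chi>4_def)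
  moreover have "Jacobi (int (a + 4 * n)) n = Jacobi (int a) n"
    by (rule Jacobi_cong[OF n]) (simp add: cong_def)
  ultimately show "\<chi>4 (a + 4 * n) * Jacobi (int (a + 4 * n)) n = \<chi>4 a * Jacobi (int a) n" by simp
  show "\<chi>4 a * Jacobi (int a) n \<in> {-1, 0, 1}"
    using Jacobi_values[OF n, of "int a"] by (auto simp: \<chi>4_def)
  have "\<chi>4 a = 0 \<longleftrightarrow> even a"
    unfolding \<chi>4_def by presburger
  moreover have "even a \<longleftrightarrow> \<not> coprime a 4"
    using coprime_power_right_iff[of a 2 2] by (simp add: coprime_right_2_iff_odd)
  ultimately show "\<chi>4 a * Jacobi (int a) n = 0 \<longleftrightarrow> \<not> coprime a (4 * n)"
    using Jacobi_eq_0_iff[OF n, of a] by simp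
  have "Jacobi (int (1 + 2 * n)) n = Jacobi 1 n"
    by (rule Jacobi_cong[OF n]) (simp add: cong_def)
  moreover have "\<chi>4 (1 + 2 * n) = -1"
    using assms unfolding \<chi>4_def by presburger
  ultimately show "\<exists>b. \<chi>4 b * Jacobi (int b) n = -1"
    using Jacobi_1 by (intro exI[of _ "1 + 2 * n"]) simp
qed

text \<open>If \<open>R c > 0\<close> then \<open>- n\<close> is a square modulo the squarefree part \<open>C\<close> of \<open>c\<close>; together with
  \<open>c = -1\<close> modulo \<open>n\<close> this yields a unimodular ternary form that represents \<open>n\<close>.\<close>

theorem sum3sq_nat:
  fixes n :: nat
  assumes "n mod 4 = 1"
  shows "\<exists>p q r. int n = p\<^sup>2 + q\<^sup>2 + r\<^sup>2"
proof -
  define \<chi> where "\<chi> = (\<lambda>m. \<chi>4 m * Jacobi (int m) n)"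
  interpret real_char "4 * n" \<chi>
    unfolding \<chi>_def by (rule real_char_Jacobi[OF assms])
  have n: "odd n" using assms by presburger
  then have "n > 0" by (cases n) auto
  have \<chi>4_n: "\<chi>4 n = 1" using assms by (simp add: \<chi>4_def)
  \<comment> \<open>Congruent to -1 modulo \<open>n\<close> and to 1 modulo 4. Both factors of
    \<open>\<chi> c0\<close> are 1, the Jacobi symbol of -1 being \<open>\<chi>4 n\<close>.\<close>
  define c0 where "c0 = 2 * n - 1"
  have "Jacobi (int c0) n = Jacobi (-1) n"
    by (rule Jacobi_cong[OF n]) (use \<open>n > 0\<close> in \<open>simp add: c0_def cong_iff_dvd_diff of_nat_diff\<close>)
  moreover have "\<chi>4 c0 = 1"
  proof -
    define j where "j = n div 4"
    have "n = 4 * j + 1" using assms unfolding j_def by presburger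
    then have "c0 = 8 * j + 1" by (simp add: c0_def)
    moreover have "(8 * j + 1) mod 4 = 1" by presburger
    ultimately show ?thesis by (simp only: \<chi>4_def simp_thms if_True)
  qed
  ultimately have "\<chi> c0 = 1" by (simp add: \<chi>_def Jacobi_minus_1[OF n] \<chi>4_n)
  then obtain c where c: "c > 0" "[c = c0] (mod (4 * n))" "R c \<noteq> 0"
    using R_nonzero_in_class by blast
  have "coprime c (4 * n)"
    using cong_eq[OF c(2)] \<open>\<chi> c0 = 1\<close> zero_iff[of c] by auto
  \<comment> \<open>The condition \<open>R c \<noteq> 0\<close> restricts only primes of odd
    exponent in \<open>c\<close>, and these are the primes of \<open>C\<close>; so a root of
    \<open>- n\<close> is sought modulo \<open>C\<close>.\<close>
  define C k where "C = squarefree_part c" and "k = square_part c"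
  have ck: "c = C * k\<^sup>2" unfolding C_def k_def by (rule squarefree_decompose)
  have "\<exists>x. int C dvd x\<^sup>2 - (- int n)"
  proof (rule squarefree_sqrt_mod)
    show "squarefree C" by (simp add: C_def)
    fix l assume l: "prime l" "l dvd C"
    have "multiplicity l c = multiplicity l C + 2 * multiplicity l k"
      using c(1) l(1) unfolding ck
      by (subst prime_elem_multiplicity_mult_distrib) (auto simp: prime_elem_multiplicity_power_distrib)
    moreover have "multiplicity l C = 1"
    proof -
      have "multiplicity l C \<le> Suc 0" unfolding C_def using l(1) by blast
      moreover have "C \<noteq> 0" by (simp add: C_def)
      then have "multiplicity l C > 0" using l by (simp add: prime_multiplicity_gt_zero_iff)
      ultimately show ?thesis by simp
    qed
    ultimately have "odd (multiplicity l c)" by simp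
    then have "\<chi> l = 1"
      using R_nonzero_imp[OF c(3,1) \<open>coprime c (4 * n)\<close> l(1)] by blast
    have "coprime l (4 * n)"
      using coprime_divisors[OF _ dvd_refl \<open>coprime c (4 * n)\<close>, of l] l(2) ck by simp
    then have "coprime l 4" "coprime l n" by simp_all
    have "odd l" using \<open>coprime l 4\<close> coprime_power_right_iff[of l 2 2] by simp
    then have "l > 2" using prime_ge_2_nat[OF l(1)] by (cases "l = 2") auto
    have "\<not> l dvd n" using \<open>coprime l n\<close> l(1) coprime_common_divisor[of l n l] by auto
    have "Legendre (- int n) (int l) = Legendre (-1) (int l) * Legendre (int n) (int l)"
      using Legendre_mult[OF l(1) \<open>l > 2\<close>, of "-1" "int n"] by simp
    also have "\<dots> = \<chi>4 l * Jacobi (int l) n"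
      using Legendre_minus_1[OF l(1) \<open>l > 2\<close>] Legendre_eq_Jacobi[OF n l(1) \<open>l > 2\<close> \<open>\<not> l dvd n\<close>] \<chi>4_n by simp
    also have "\<dots> = 1" using \<open>\<chi> l = 1\<close> by (simp add: \<chi>_def)
    finally have "QuadRes (int l) (- int n)" by (auto simp: Legendre_def split: if_splits)
    then show "\<exists>x. int l dvd x\<^sup>2 - (- int n)" by (auto simp: QuadRes_def cong_iff_dvd_diff)
  qed
  then obtain x where x: "int C dvd x\<^sup>2 + int n" by auto
  have "int n dvd int c + 1"
  proof -
    have "int (4 * n) dvd int c - int c0"
      using c(2) unfolding cong_int_iff[symmetric] cong_iff_dvd_diff .
    then have "int n dvd int c - int c0" by (simp add: dvd_mult_right)
    moreover have "int c + 1 = (int c - int c0) + int n * 2" using \<open>n > 0\<close> by (simp add: c0_def of_nat_diff)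
    ultimately show ?thesis by (metis dvd_add dvd_triv_left)
  qed
  then obtain d where d: "int c + 1 = int n * d" by (elim dvdE)
  have "d > 0"
  proof -
    have "int n * d > 0" unfolding d[symmetric] by simp
    then show ?thesis by (simp add: zero_less_mult_iff)
  qed
  \<comment> \<open>Modulo \<open>C\<close>, \<open>d\<close> is inverse to \<open>n\<close> because
    n d - 1 = c. So the root \<open>x\<close> of \<open>- n\<close> yields the root
    \<open>d * x\<close> of \<open>- d\<close>.\<close>
  have "int C dvd (d * x)\<^sup>2 + d"
  proof -
    have "(d * x)\<^sup>2 + d = d\<^sup>2 * (x\<^sup>2 + int n) - d * (int n * d - 1)"
      by (simp add: algebra_simps power2_eq_square)
    also have "int n * d - 1 = int C * int (k\<^sup>2)" using d ck by simp
    finally show ?thesis using x by (auto intro: dvd_diff)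
  qed
  then obtain A where A: "(d * x)\<^sup>2 + d = int C * A" by (elim dvdE)
  have "C > 0" using c(1) ck by (cases C) auto
  \<comment> \<open>The Gram matrix is (C, d x, 0; d x, A, k; 0, k, n). Its upper left minor is
    \<open>d\<close>, so its determinant is n d - C k^2 = (c + 1) - c = 1; the last unit vector has
    norm \<open>n\<close>.\<close>
  have "ternary (int C) (d * x) 0 A (int k) (int n) 0 0 1 = int n" by (simp add: ternary_def)
  moreover have "\<exists>p q r. ternary (int C) (d * x) 0 A (int k) (int n) 0 0 1 = p\<^sup>2 + q\<^sup>2 + r\<^sup>2"
  proof (rule ternary_unimodular_sum3sq)
    show "int C > 0" using \<open>C > 0\<close> by simp
    show "int C * A - (d * x)\<^sup>2 > 0" using A \<open>d > 0\<close> by simp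
    have "int C * (A * int n - (int k)\<^sup>2) - (d * x) * ((d * x) * int n - 0 * int k) + 0 * ((d * x) * int k - 0 * A)
        = int n * (int C * A - (d * x)\<^sup>2) - int C * (int k)\<^sup>2"
      by (simp add: algebra_simps power2_eq_square)
    also have "int C * A - (d * x)\<^sup>2 = d" using A by simp
    also have "int n * d - int C * (int k)\<^sup>2 = 1" using d ck by simp
    finally show "int C * (A * int n - (int k)\<^sup>2) - (d * x) * ((d * x) * int n - 0 * int k) + 0 * ((d * x) * int k - 0 * A) = 1" .
  qed
  ultimately show ?thesis by simp
qed

section \<open>Diagonal forms derived from three squares\<close>

lemma mod_add3_eq: "(x mod k + y mod k + z mod k) mod k = (x + y + z) mod (k :: int)"
proof -
  have "(x mod k + y mod k + z mod k) mod k = ((x mod k + y mod k) mod k + z mod k) mod k"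
    by (rule mod_add_left_eq[symmetric])
  also have "\<dots> = ((x + y) mod k + z mod k) mod k" by (simp only: mod_add_eq)
  also have "\<dots> = (x + y + z) mod k" by (rule mod_add_eq)
  finally show ?thesis .
qed

lemma square_mod_4: "(x :: int)\<^sup>2 mod 4 = (if even x then 0 else 1)"
proof (cases "even x")
  case False
  then obtain b where "x = 2 * b + 1" by (elim oddE)
  then have "x\<^sup>2 = 1 + 4 * (b\<^sup>2 + b)" by (simp add: power2_eq_square algebra_simps)
  then have "x\<^sup>2 mod 4 = 1" by (simp only: mod_mult_self2) simp
  then show ?thesis using False by simp
qed (auto elim!: evenE simp: power2_eq_square)

lemma form_1_4_4:
  fixes S :: int
  assumes "S > 0" "S mod 4 = 1"
  shows "\<exists>a b c. S = a\<^sup>2 + 4 * b\<^sup>2 + 4 * c\<^sup>2"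
proof -
  have "nat S mod 4 = 1" using assms nat_mod_distrib[of S 4] by simp
  then obtain p q r where pqr: "int (nat S) = p\<^sup>2 + q\<^sup>2 + r\<^sup>2" using sum3sq_nat by blast
  then have S: "S = p\<^sup>2 + q\<^sup>2 + r\<^sup>2" using assms(1) by simp
  have *: ?thesis if eq: "S = x\<^sup>2 + y\<^sup>2 + z\<^sup>2" and ev: "even y" "even z" for x y z
  proof -
    obtain b c where "y = 2 * b" "z = 2 * c" using ev by (elim evenE)
    then have "S = x\<^sup>2 + 4 * b\<^sup>2 + 4 * c\<^sup>2" using eq by (simp add: power_mult_distrib)
    then show ?thesis by blast
  qed
  have "(p\<^sup>2 mod 4 + q\<^sup>2 mod 4 + r\<^sup>2 mod 4) mod 4 = 1"
    using assms(2) unfolding S mod_add3_eq .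
  then consider "even q" "even r" | "even p" "even r" | "even p" "even q"
    by (auto simp: square_mod_4 split: if_splits)
  then show ?thesis
  proof cases
    case 1 then show ?thesis using *[of p q r] S by simp
  next
    case 2 then show ?thesis using *[of q p r] S by simp
  next
    case 3 then show ?thesis using *[of r p q] S by simp
  qed
qed

lemma square_mod_3: "(x :: int)\<^sup>2 mod 3 = (if 3 dvd x then 0 else 1)"
proof -
  have *: "x\<^sup>2 mod 3 = (x mod 3)\<^sup>2 mod 3" by (simp only: power_mod)
  have "x mod 3 = 0 \<or> x mod 3 = 1 \<or> x mod 3 = 2" by presburger
  then show ?thesis
    unfolding * dvd_eq_mod_eq_0 by (elim disjE) (simp_all del: power_mod)
qed

text \<open>The vectors (0, 1, -1), (1, 1, 1), (-2, 1, 1) are orthogonal of norms 2, 3, 6. They span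
  the (a, b, c) with \<open>b - c\<close> even and \<open>a + b + c\<close> divisible by 3. Signs of
  \<open>b\<close> and \<open>c\<close> achieve the latter unless exactly one of the three is prime
  to 3, that is, \<open>S mod 3 = 1\<close>.\<close>

lemma sum3sq_imp_2_3_6:
  fixes S :: int
  assumes S: "S = a\<^sup>2 + b\<^sup>2 + c\<^sup>2" and "even (b - c)" "S mod 3 \<noteq> 1"
  shows "\<exists>v u w. S = 2 * v\<^sup>2 + 3 * u\<^sup>2 + 6 * w\<^sup>2"
proof -
  have "(a\<^sup>2 mod 3 + b\<^sup>2 mod 3 + c\<^sup>2 mod 3) mod 3 \<noteq> 1"
    using assms(3) unfolding S mod_add3_eq .
  then have "(3 dvd a \<longleftrightarrow> 3 dvd b) \<and> (3 dvd b \<longleftrightarrow> 3 dvd c) \<or> (3 dvd a \<and> \<not> 3 dvd b \<and> \<not> 3 dvd c)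
      \<or> (\<not> 3 dvd a \<and> 3 dvd b \<and> \<not> 3 dvd c) \<or> (\<not> 3 dvd a \<and> \<not> 3 dvd b \<and> 3 dvd c)"
    by (auto simp: square_mod_3 split: if_splits)
  then have "3 dvd a + b + c \<or> 3 dvd a + b - c \<or> 3 dvd a - b + c \<or> 3 dvd a - b - c"
    by presburger
  moreover have ?thesis if bc: "3 dvd a + b' + c'" "b'\<^sup>2 = b\<^sup>2" "c'\<^sup>2 = c\<^sup>2" "even (b' - c')" for b' c'
  proof -
    obtain u where u: "a + b' + c' = 3 * u" using bc(1) by (elim dvdE)
    obtain v where v: "b' - c' = 2 * v" using bc(4) by (elim dvdE)
    have "even (u - a)" using u v by presburger
    then obtain w where w: "u - a = 2 * w" by (elim dvdE)
    have abc: "a = u - 2 * w" "b' = u + w + v" "c' = u + w - v" using u v w by simp_all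
    have "S = a\<^sup>2 + b'\<^sup>2 + c'\<^sup>2" using S bc by simp
    also have "\<dots> = 2 * v\<^sup>2 + 3 * u\<^sup>2 + 6 * w\<^sup>2"
      unfolding abc by (simp add: algebra_simps power2_eq_square)
    finally show ?thesis by blast
  qed
  from this[of b c] this[of b "-c"] this[of "-b" c] this[of "-b" "-c"]
  have "3 dvd a + b + c \<Longrightarrow> ?thesis" "3 dvd a + b - c \<Longrightarrow> ?thesis"
    "3 dvd a - b + c \<Longrightarrow> ?thesis" "3 dvd a - b - c \<Longrightarrow> ?thesis"
    using assms(2) by simp_all
  ultimately show ?thesis by blast
qed

lemma form_2_3_6:
  fixes S :: int
  assumes "S > 0" "S mod 4 = 1" "S mod 3 \<noteq> 1"
  shows "\<exists>v u w. S = 2 * v\<^sup>2 + 3 * u\<^sup>2 + 6 * w\<^sup>2"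
proof -
  obtain a b c where "S = a\<^sup>2 + 4 * b\<^sup>2 + 4 * c\<^sup>2" using form_1_4_4 assms by blast
  then have "S = a\<^sup>2 + (2 * b)\<^sup>2 + (2 * c)\<^sup>2" by (simp add: power_mult_distrib)
  then show ?thesis by (rule sum3sq_imp_2_3_6) (use assms in auto)
qed

text \<open>In a representation of \<open>3 * S\<close> by the form with coefficients 2, 3, 6 the
  first coordinate is divisible by 3; dividing by 3 turns the coefficients into 6, 1, 2.\<close>

lemma form_1_2_6:
  fixes S :: int
  assumes "S > 0" "S mod 4 = 3"
  shows "\<exists>u w v. S = u\<^sup>2 + 2 * w\<^sup>2 + 6 * v\<^sup>2"
proof -
  have "(3 * S) mod 4 = 1" "(3 * S) mod 3 \<noteq> 1" using assms(2) by presburger+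
  then obtain v u w where *: "3 * S = 2 * v\<^sup>2 + 3 * u\<^sup>2 + 6 * w\<^sup>2"
    using form_2_3_6[of "3 * S"] assms(1) by auto
  then have "2 * v\<^sup>2 = 3 * (S - u\<^sup>2 - 2 * w\<^sup>2)" by simp
  then have "3 dvd v\<^sup>2" by presburger
  then have "v\<^sup>2 mod 3 = 0" by simp
  then have "3 dvd v" by (simp add: square_mod_3 split: if_splits)
  then obtain t where "v = 3 * t" by (elim dvdE)
  then have "S = u\<^sup>2 + 2 * w\<^sup>2 + 6 * t\<^sup>2" using * by (simp add: power_mult_distrib)
  then show ?thesis by blast
qed

text \<open>Squares are 0, 1 or 4 modulo 5; if no two of the three squares add up to 0, the total is
  2 or 3, which is excluded. A sum of two squares divisible by 5 is 5 times a sum of two squares, by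
  division by one of the Gaussian integers 2 + i and 2 - i.\<close>

lemma form_1_5_5:
  fixes S :: int
  assumes "S > 0" "S mod 4 = 1" "S mod 5 \<in> {0, 1, 4}"
  shows "\<exists>a s t. S = a\<^sup>2 + 5 * s\<^sup>2 + 5 * t\<^sup>2"
proof -
  obtain a b c where "S = a\<^sup>2 + 4 * b\<^sup>2 + 4 * c\<^sup>2" using form_1_4_4 assms by blast
  then have S: "S = a\<^sup>2 + (2 * b)\<^sup>2 + (2 * c)\<^sup>2" by (simp add: power_mult_distrib)
  have sq: "x\<^sup>2 mod 5 \<in> {0, 1, 4}" for x :: int
  proof -
    have *: "x\<^sup>2 mod 5 = (x mod 5)\<^sup>2 mod 5" by (simp only: power_mod)
    have "x mod 5 = 0 \<or> x mod 5 = 1 \<or> x mod 5 = 2 \<or> x mod 5 = 3 \<or> x mod 5 = 4" by presburger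
    then show ?thesis
      unfolding * by (elim disjE) (simp_all del: power_mod)
  qed
  have *: ?thesis if "S = z\<^sup>2 + x\<^sup>2 + y\<^sup>2" "(x\<^sup>2 mod 5 + y\<^sup>2 mod 5) mod 5 = 0" for x y z
  proof -
    have "5 dvd x\<^sup>2 + y\<^sup>2" using that(2) by (simp add: mod_simps dvd_eq_mod_eq_0)
    then have "5 dvd 5 * x\<^sup>2 - (x\<^sup>2 + y\<^sup>2)" by (intro dvd_diff) auto
    also have "5 * x\<^sup>2 - (x\<^sup>2 + y\<^sup>2) = (2 * x - y) * (2 * x + y)" by (simp add: power2_eq_square algebra_simps)
    finally have "5 dvd 2 * x - y \<or> 5 dvd 2 * x + y" by (simp add: prime_dvd_mult_iff)
    then obtain y' where y': "y'\<^sup>2 = y\<^sup>2" "5 dvd 2 * x - y'"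
      by (metis diff_minus_eq_add power2_minus)
    then obtain t where t: "2 * x - y' = 5 * t" by (elim dvdE)
    have "5 dvd x + 2 * y'" using y'(2) by presburger
    then obtain s where s: "x + 2 * y' = 5 * s" by (elim dvdE)
    have xy: "x = s + 2 * t" "y' = 2 * s - t" using s t by simp_all
    have "x\<^sup>2 + y'\<^sup>2 = 5 * s\<^sup>2 + 5 * t\<^sup>2" unfolding xy by (simp add: algebra_simps power2_eq_square)
    then have "S = z\<^sup>2 + 5 * s\<^sup>2 + 5 * t\<^sup>2" using that(1) y'(1) by simp
    then show ?thesis by blast
  qed
  define A B C where "A = a\<^sup>2 mod 5" and "B = (2 * b)\<^sup>2 mod 5" and "C = (2 * c)\<^sup>2 mod 5"
  have "S mod 5 = (A + B + C) mod 5"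
    unfolding S A_def B_def C_def mod_add3_eq ..
  then have "(A + B + C) mod 5 \<in> {0, 1, 4}" using assms(3) by simp
  moreover have "A = 0 \<or> A = 1 \<or> A = 4" "B = 0 \<or> B = 1 \<or> B = 4" "C = 0 \<or> C = 1 \<or> C = 4"
    unfolding A_def B_def C_def using sq by blast+
  ultimately have "(A + B) mod 5 = 0 \<or> (A + C) mod 5 = 0 \<or> (B + C) mod 5 = 0"
    by (elim disjE; hypsubst; simp)
  then consider "(A + B) mod 5 = 0" | "(A + C) mod 5 = 0" | "(B + C) mod 5 = 0" by blast
  then show ?thesis
  proof cases
    case 1
    show ?thesis by (rule *[of "2 * c" a "2 * b"]) (use S 1 in \<open>simp_all only: A_def B_def C_def add_ac\<close>)
  next
    case 2
    show ?thesis by (rule *[of "2 * b" a "2 * c"]) (use S 2 in \<open>simp_all only: A_def B_def C_def add_ac\<close>)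
  next
    case 3
    show ?thesis by (rule *[of a "2 * b" "2 * c"]) (use S 3 in \<open>simp_all only: A_def B_def C_def add_ac\<close>)
  qed
qed

section \<open>Universal quaternary forms\<close>

lemma same_parity_sum2sq:
  assumes "even (x - y :: int)"
  obtains s t where "x = s + t" "y = s - t" "x\<^sup>2 + y\<^sup>2 = 2 * s\<^sup>2 + 2 * t\<^sup>2"
proof -
  obtain t where t: "x - y = 2 * t" using assms by (elim dvdE)
  have *: "x = (y + t) + t" "y = (y + t) - t" using t by simp_all
  show ?thesis
    by (rule that[OF *]) (use t in \<open>simp add: power2_eq_square algebra_simps\<close>)
qed

text \<open>For odd \<open>m\<close>, write \<open>2 * m - 1\<close> as a^2 + 4 b^2 + 4 c^2 with a =
  2 e + 1; halving 2 m = (a^2 + 1) + 4 b^2 + 4 c^2 gives e^2 + (e + 1)^2 + (b + c)^2 + (b - c)^2.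
  Even \<open>m\<close> reduces to \<open>m / 2\<close>.\<close>

lemma sum4sq:
  fixes m :: int
  assumes "m \<ge> 0"
  shows "\<exists>a b c d. m = a\<^sup>2 + b\<^sup>2 + c\<^sup>2 + d\<^sup>2"
  using assms
proof (induction "nat m" arbitrary: m rule: less_induct)
  case less
  show ?case
  proof (cases "even m")
    case True
    then obtain k where k: "m = 2 * k" by (elim dvdE)
    show ?thesis
    proof (cases "m = 0")
      case False
      then have "nat k < nat m" "k \<ge> 0" using k less.prems by auto
      then obtain a b c d where "k = a\<^sup>2 + b\<^sup>2 + c\<^sup>2 + d\<^sup>2" using less.hyps by blast
      then have "m = (a + b)\<^sup>2 + (a - b)\<^sup>2 + (c + d)\<^sup>2 + (c - d)\<^sup>2"
        unfolding k by (simp add: power2_eq_square algebra_simps)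
      then show ?thesis by blast
    qed (auto intro!: exI[of _ 0])
  next
    case False
    then have "(2 * m - 1) mod 4 = 1" by presburger
    moreover have "2 * m - 1 > 0" using False less.prems by (cases "m = 0") auto
    ultimately obtain a b c where abc: "2 * m - 1 = a\<^sup>2 + 4 * b\<^sup>2 + 4 * c\<^sup>2"
      using form_1_4_4 by blast
    then have "a\<^sup>2 = 2 * (m - 1 - 2 * b\<^sup>2 - 2 * c\<^sup>2) + 1" by simp
    then have "odd (a\<^sup>2)" by presburger
    then have "odd a" by simp
    then obtain e where "a = 2 * e + 1" by (elim oddE)
    then have "m = (e + 1)\<^sup>2 + e\<^sup>2 + (b + c)\<^sup>2 + (b - c)\<^sup>2"
      using abc by (simp add: power2_eq_square algebra_simps)
    then show ?thesis by blast
  qed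
qed

lemma form_1_1_2_2:
  fixes m :: int
  assumes "m \<ge> 0"
  shows "\<exists>a b c d. m = a\<^sup>2 + b\<^sup>2 + 2 * c\<^sup>2 + 2 * d\<^sup>2"
proof -
  obtain a b c d where m: "m = a\<^sup>2 + b\<^sup>2 + c\<^sup>2 + d\<^sup>2" using sum4sq assms by blast
  have *: ?thesis if "m = x\<^sup>2 + y\<^sup>2 + z\<^sup>2 + w\<^sup>2" "even (z - w)" for x y z w
    using same_parity_sum2sq[OF that(2)] that(1) by (metis add.assoc)
  have "even (a - b) \<or> even (a - c) \<or> even (b - c)" by presburger
  then show ?thesis
    using *[of c d a b] *[of b d a c] *[of a d b c] m by (elim disjE) simp_all
qed

text \<open>For even \<open>m\<close>, doubling a representation of \<open>m / 2\<close> turns the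
  coefficients 1, 1, 2, 2 into 2, 2, 4, 4, and one 4 is absorbed as the square of an even
  coordinate. For odd \<open>m\<close>, one of the coordinates with coefficient 1 is even.\<close>

lemma form_1_2_2_4:
  fixes m :: int
  assumes "m \<ge> 0"
  shows "\<exists>a b c d. m = a\<^sup>2 + 2 * b\<^sup>2 + 2 * c\<^sup>2 + 4 * d\<^sup>2"
proof (cases "even m")
  case True
  then obtain k where k: "m = 2 * k" by (elim dvdE)
  then obtain a b c d where "k = a\<^sup>2 + b\<^sup>2 + 2 * c\<^sup>2 + 2 * d\<^sup>2" using form_1_1_2_2[of k] assms by auto
  then have "m = (2 * d)\<^sup>2 + 2 * a\<^sup>2 + 2 * b\<^sup>2 + 4 * c\<^sup>2" unfolding k by (simp add: power_mult_distrib)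
  then show ?thesis by blast
next
  case False
  obtain a b c d where m: "m = a\<^sup>2 + b\<^sup>2 + 2 * c\<^sup>2 + 2 * d\<^sup>2" using form_1_1_2_2 assms by blast
  have *: ?thesis if "m = x\<^sup>2 + y\<^sup>2 + 2 * c\<^sup>2 + 2 * d\<^sup>2" "even y" for x y
  proof -
    obtain z where "y = 2 * z" using \<open>even y\<close> by (elim dvdE)
    then have "m = x\<^sup>2 + 2 * c\<^sup>2 + 2 * d\<^sup>2 + 4 * z\<^sup>2" using that by (simp add: power_mult_distrib)
    then show ?thesis by blast
  qed
  have "even a \<or> even b" using False m by auto
  then show ?thesis using *[of a b] *[of b a] m by auto
qed

text \<open>Even \<open>m\<close> by the same doubling. For odd \<open>m\<close> with
  \<open>b\<close> and \<open>c\<close> odd, 2 b^2 + 2 c^2 becomes 4 e^2 + 4 f^2; of the three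
  coordinates with coefficient 4 two have equal parity, and they give 8 s^2 + 8 t^2 = 2 (2 s)^2 + 8
  t^2.\<close>

lemma form_1_2_4_8:
  fixes m :: int
  assumes "m \<ge> 0"
  shows "\<exists>a b c d. m = a\<^sup>2 + 2 * b\<^sup>2 + 4 * c\<^sup>2 + 8 * d\<^sup>2"
proof (cases "even m")
  case True
  then obtain k where k: "m = 2 * k" by (elim dvdE)
  then obtain a b c d where "k = a\<^sup>2 + 2 * b\<^sup>2 + 2 * c\<^sup>2 + 4 * d\<^sup>2" using form_1_2_2_4[of k] assms by auto
  then have "m = (2 * b)\<^sup>2 + 2 * a\<^sup>2 + 4 * c\<^sup>2 + 8 * d\<^sup>2" unfolding k by (simp add: power_mult_distrib)
  then show ?thesis by blast
next
  case False
  obtain a b c d where m: "m = a\<^sup>2 + 2 * b\<^sup>2 + 2 * c\<^sup>2 + 4 * d\<^sup>2" using form_1_2_2_4 assms by blast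
  have ev: ?thesis if "m = a\<^sup>2 + 2 * x\<^sup>2 + 2 * y\<^sup>2 + 4 * d\<^sup>2" "even y" for x y
  proof -
    obtain z where "y = 2 * z" using \<open>even y\<close> by (elim dvdE)
    then have "m = a\<^sup>2 + 2 * x\<^sup>2 + 4 * d\<^sup>2 + 8 * z\<^sup>2" using that by (simp add: power_mult_distrib)
    then show ?thesis by blast
  qed
  have *: ?thesis if eq: "m = a\<^sup>2 + 4 * x\<^sup>2 + 4 * y\<^sup>2 + 4 * z\<^sup>2" and "even (x - y)" for x y z
  proof -
    obtain s t where "x\<^sup>2 + y\<^sup>2 = 2 * s\<^sup>2 + 2 * t\<^sup>2"
      using same_parity_sum2sq[OF \<open>even (x - y)\<close>] by metis
    then have "m = a\<^sup>2 + 2 * (2 * s)\<^sup>2 + 4 * z\<^sup>2 + 8 * t\<^sup>2" using eq by (simp add: power_mult_distrib)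
    then show ?thesis by blast
  qed
  show ?thesis
  proof (cases "even b \<or> even c")
    case True
    then show ?thesis using ev[of c b] ev[of b c] m by auto
  next
    case False
    then have "even (b - c)" by simp
    then obtain e f where ef: "b = e + f" "c = e - f" "b\<^sup>2 + c\<^sup>2 = 2 * e\<^sup>2 + 2 * f\<^sup>2"
      by (rule same_parity_sum2sq)
    then have m': "m = a\<^sup>2 + 4 * d\<^sup>2 + 4 * e\<^sup>2 + 4 * f\<^sup>2" using m by simp
    have "even (d - e) \<or> even (d - f) \<or> even (e - f)" by presburger
    then show ?thesis
      using *[of d e f] *[of d f e] *[of e f d] m' by (elim disjE) simp_all
  qed
qed

section \<open>Representations by diagonal lattices\<close>

lemma represents_Nil [simp]: "represents [] m \<longleftrightarrow> m = 0"
  by (auto simp: represents_def diag_vectors_def diag_Q_def)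

lemma represents_Cons: "represents (c # a) m \<longleftrightarrow> (\<exists>x. represents a (m - c * x\<^sup>2))"
proof
  assume "represents (c # a) m"
  then obtain y where y: "length y = Suc (length a)" "m = diag_Q (c # a) y"
    by (auto simp: represents_def diag_vectors_def)
  then obtain x xs where "y = x # xs" by (cases y) auto
  then have "length xs = length a" "m - c * x\<^sup>2 = diag_Q a xs"
    using y by (auto simp: diag_Q_def sum.lessThan_Suc_shift simp del: sum.lessThan_Suc)
  then show "\<exists>x. represents a (m - c * x\<^sup>2)"
    by (auto simp: represents_def diag_vectors_def)
next
  assume "\<exists>x. represents a (m - c * x\<^sup>2)"
  then obtain x xs where "length xs = length a" "m - c * x\<^sup>2 = diag_Q a xs"
    by (auto simp: represents_def diag_vectors_def)
  then have "length (x # xs) = length (c # a)" "m = diag_Q (c # a) (x # xs)"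
    by (auto simp: diag_Q_def sum.lessThan_Suc_shift simp del: sum.lessThan_Suc)
  then show "represents (c # a) m"
    unfolding represents_def diag_vectors_def by blast
qed

lemma represents_subseq: "subseq b a \<Longrightarrow> represents b m \<Longrightarrow> represents a m"
proof (induction arbitrary: m rule: list_emb.induct)
  case (list_emb_Nil ys)
  then have "m = 0" by simp
  have "represents ys 0" by (induction ys) (auto simp: represents_Cons intro!: exI[of _ 0])
  then show ?case using \<open>m = 0\<close> by simp
next
  case (list_emb_Cons xs ys y)
  then show ?case by (auto simp: represents_Cons intro!: exI[of _ 0])
next
  case (list_emb_Cons2 x y xs ys)
  then show ?case by (auto simp: represents_Cons)
qed

section \<open>Scalar products and orthogonal frames\<close>

fun dot :: "int list \<Rightarrow> int list \<Rightarrow> int list \<Rightarrow> int" where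
  "dot (c # a) (x # xs) (y # ys) = c * x * y + dot a xs ys"
| "dot _ _ _ = 0"

definition shift :: "int list \<Rightarrow> int \<Rightarrow> int list \<Rightarrow> int list" where
  "shift x t v = map2 (\<lambda>y w. y + t * w) x v"

lemma represents_dot:
  "length x = length a \<Longrightarrow> represents a (dot a x x)"
proof (induction a x rule: list_induct2')
  case (4 c a x xs)
  then show ?case by (auto simp: represents_Cons power2_eq_square intro!: exI[of _ x])
qed auto

lemma dot_shift:
  assumes "length x = length a" "length v = length a" "length w = length a"
  shows "dot a (shift x t v) w = dot a x w + t * dot a v w"
    and "dot a w (shift x t v) = dot a w x + t * dot a w v"
  using assms
proof (induction a arbitrary: x v w)
  case (Cons c a)
  {
    case 1 then show ?case
      using Cons(1)[of "tl x" "tl v" "tl w"]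
      by (cases x; cases v; cases w) (auto simp: shift_def algebra_simps)
  next
    case 2 then show ?case
      using Cons(2)[of "tl x" "tl v" "tl w"]
      by (cases x; cases v; cases w) (auto simp: shift_def algebra_simps)
  }
qed auto

lemma dot_commute: "dot a x y = dot a y x"
  by (induction a x y rule: dot.induct) auto

fun frame :: "int list \<Rightarrow> int \<Rightarrow> int list \<Rightarrow> int list list \<Rightarrow> bool" where
  "frame a N [] [] \<longleftrightarrow> True"
| "frame a N (p # ps) (v # vs) \<longleftrightarrow>
     length v = length a \<and> dot a v v = N * p \<and> list_all (\<lambda>w. dot a v w = 0) vs \<and> frame a N ps vs"
| "frame a N _ _ \<longleftrightarrow> False"

text \<open>Adding \<open>t\<close> times the first frame vector to \<open>x\<close> raises the norm
  by \<open>N * p * t\<^sup>2\<close>, because the two are orthogonal, and preserves orthogonality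
  to the remaining vectors.\<close>

lemma represents_frame:
  assumes "frame a N ps vs" "length x = length a" "list_all (\<lambda>v. dot a x v = 0) vs" "represents ps S"
  shows "represents a (dot a x x + N * S)"
  using assms
proof (induction a N ps vs arbitrary: x S rule: frame.induct)
  case (1 a N)
  then show ?case by (simp add: represents_dot)
next
  case (2 a N p ps v vs)
  obtain t where t: "represents ps (S - p * t\<^sup>2)" using 2(5) by (auto simp: represents_Cons)
  have len: "length v = length a" and N: "dot a v v = N * p" and "frame a N ps vs"
    and orth: "dot a x v = 0" using 2 by auto
  have len': "length (shift x t v) = length a" using len 2 by (simp add: shift_def)
  have lens: "length w = length a" if "w \<in> set vs" for w
    using \<open>frame a N ps vs\<close> that by (induction a N ps vs rule: frame.induct) auto
  have "list_all (\<lambda>w. dot a (shift x t v) w = 0) vs"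
    using 2(2,4) len 2(3) lens by (auto simp: list_all_iff dot_shift)
  from 2(1)[OF \<open>frame a N ps vs\<close> len' this t]
  have "represents a (dot a (shift x t v) (shift x t v) + N * (S - p * t\<^sup>2))" .
  also have "dot a (shift x t v) (shift x t v) = dot a x x + N * p * t\<^sup>2"
    using len len' 2(3) orth N by (simp add: dot_shift dot_commute[of a v x] power2_eq_square algebra_simps)
  finally show ?case by (simp add: algebra_simps)
qed auto

definition pattern :: "int list \<times> int \<times> int list \<Rightarrow> bool" where
  "pattern = (\<lambda>(ps, M, Rs). \<forall>S. S > 0 \<longrightarrow> S mod M \<in> set Rs \<longrightarrow> represents ps S)"

text \<open>Each list states its conditions in one modulus: 5, 9 modulo 12 are the classes that are
  1 modulo 4 and not 1 modulo 3; 1, 5, 9 modulo 20 are those that are 1 modulo 4 and 0, 1 or 4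
  modulo 5. Modulus 1 means no condition.\<close>

definition patterns :: "(int list \<times> int \<times> int list) list" where
  "patterns = [([1,4,4], 4, [1]), ([1,2,6], 4, [3]), ([2,3,6], 12, [5,9]), ([1,5,5], 20, [1,5,9]),
     ([1,2,2,4], 1, [0]), ([1,2,4,8], 1, [0])]"

lemma represents_3: "represents [p, q, r] (p * x\<^sup>2 + q * y\<^sup>2 + r * z\<^sup>2)"
  unfolding represents_Cons by (intro exI[of _ x] exI[of _ y] exI[of _ z]) simp

lemma represents_4: "represents [p, q, r, s] (p * x\<^sup>2 + q * y\<^sup>2 + r * z\<^sup>2 + s * w\<^sup>2)"
  unfolding represents_Cons by (intro exI[of _ x] exI[of _ y] exI[of _ z] exI[of _ w]) simp

lemma patterns: "list_all pattern patterns"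
proof -
  have "represents [1, 4, 4] S" if "S > 0" "S mod 4 = 1" for S
    using form_1_4_4[OF that] represents_3[of 1 4 4] by auto
  moreover have "represents [1, 2, 6] S" if "S > 0" "S mod 4 = 3" for S
    using form_1_2_6[OF that] represents_3[of 1 2 6] by auto
  moreover have "represents [2, 3, 6] S" if "S > 0" "S mod 12 = 5 \<or> S mod 12 = 9" for S
  proof -
    have "S mod 4 = 1" "S mod 3 \<noteq> 1"
      using that(2) mod_mod_cancel[of 4 12 S] mod_mod_cancel[of 3 12 S] by auto
    then show ?thesis using form_2_3_6[OF that(1)] represents_3[of 2 3 6] by auto
  qed
  moreover have "represents [1, 5, 5] S" if "S > 0" "S mod 20 = 1 \<or> S mod 20 = 5 \<or> S mod 20 = 9" for S
  proof -
    have "S mod 4 = 1" "S mod 5 = 0 \<or> S mod 5 = 1 \<or> S mod 5 = 4"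
      using that(2) mod_mod_cancel[of 4 20 S] mod_mod_cancel[of 5 20 S] by auto
    then show ?thesis using form_1_5_5[OF that(1)] represents_3[of 1 5 5] by auto
  qed
  moreover have "represents [1, 2, 2, 4] S" if "S > 0" for S
    using form_1_2_2_4[of S] represents_4[of 1 2 2 4] that by auto
  moreover have "represents [1, 2, 4, 8] S" if "S > 0" for S
    using form_1_2_4_8[of S] represents_4[of 1 2 4 8] that by auto
  ultimately show ?thesis by (simp add: patterns_def pattern_def)
qed

text \<open>A sieve: \<open>rs\<close> are the residues modulo \<open>K\<close> still open. They are
  lifted to the modulus \<open>lcm K L\<close>, and the lifts covered modulo \<open>L\<close> are
  removed, so later moduli refine only what is left.\<close>

fun uncovered :: "int \<Rightarrow> int list \<Rightarrow> (int \<times> int list) list \<Rightarrow> int list" where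
  "uncovered K rs [] = rs"
| "uncovered K rs ((L, l) # ts) = (let K' = lcm K L in
     uncovered K' (filter (\<lambda>r. r mod L \<notin> set l)
       (concat (map (\<lambda>r. map (\<lambda>j. r + K * j) [0..K' div K - 1]) rs))) ts)"

lemma uncovered_Nil:
  assumes "uncovered K rs ts = []" "K > 0" "m mod K \<in> set rs" "\<forall>(L, l)\<in>set ts. L > 0"
  shows "\<exists>(L, l)\<in>set ts. m mod L \<in> set l"
  using assms
proof (induction K rs ts rule: uncovered.induct)
  case (2 K rs L l ts)
  define K' where "K' = lcm K L"
  have K': "K' > 0" "K dvd K'" "L dvd K'" using 2(3,5) by (auto simp: K'_def lcm_pos_int)
  show ?case
  proof (cases "m mod L \<in> set l")
    case False
    define j where "j = m mod K' div K"
    have "m mod K' mod K = m mod K" "m mod K' mod L = m mod L"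
      using K' by (simp_all add: mod_mod_cancel)
    then have m: "m mod K' = m mod K + K * j" "m mod K' mod L \<notin> set l"
      using False mod_mult_div_eq[of "m mod K'" K] by (simp_all add: j_def)
    have "0 \<le> j" using K'(1) 2(3) by (simp add: j_def pos_imp_zdiv_nonneg_iff)
    moreover have "K * j < K'"
      using m(1) pos_mod_bound[OF K'(1), of m] pos_mod_sign[OF 2(3), of m] by linarith
    then have "K * j < K * (K' div K)" using K'(2) by simp
    then have "j < K' div K" using 2(3) by simp
    ultimately have "m mod K' \<in> set (filter (\<lambda>r. r mod L \<notin> set l)
       (concat (map (\<lambda>r. map (\<lambda>j. r + K * j) [0..K' div K - 1]) rs)))"
      using m 2(4) by (auto intro!: bexI[of _ "m mod K"] rev_image_eqI[of j])
    then have "\<exists>(L, l)\<in>set ts. m mod L \<in> set l"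
      using 2(1)[OF K'_def] 2(2,5) K'(1) by (simp add: Let_def K'_def)
    then show ?thesis by auto
  qed auto
qed simp

text \<open>An entry \<open>((ps, M, Rs), N, vs, xs)\<close> of \<open>cs\<close> consists of a form \<open>ps\<close> that represents all positive
  \<open>S\<close> with \<open>S mod M \<in> Rs\<close>, of orthogonal vectors \<open>vs\<close> spanning \<open>N\<close> times this form, and of vectors \<open>x\<close>
  orthogonal to \<open>vs\<close>, so that \<open>Q x + N * S\<close> is represented. Together the entries have to cover all
  integers.\<close>

definition certificate ::
    "int list \<Rightarrow> int \<Rightarrow> ((int list \<times> int \<times> int list) \<times> int \<times> int list list \<times> int list list) list \<Rightarrow> bool" where
  "certificate a B cs \<longleftrightarrow>
     list_all (\<lambda>((ps, M, Rs), N, vs, xs).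
       (ps, M, Rs) \<in> set patterns \<and> N > 0 \<and> M > 0 \<and> list_all (\<lambda>R. 0 \<le> R \<and> R < M) Rs \<and> frame a N ps vs \<and>
       list_all (\<lambda>x. length x = length a \<and> dot a x x \<le> B \<and> list_all (\<lambda>v. dot a x v = 0) vs) xs) cs \<and>
     uncovered 1 [0] (map (\<lambda>((ps, M, Rs), N, vs, xs).
       (N * M, map (\<lambda>(x, R). (dot a x x + N * R) mod (N * M)) (List.product xs Rs))) cs) = []"

lemma represents_certificate:
  assumes "certificate a B cs" "m > B"
  shows "represents a m"
proof -
  have "\<exists>(L, l)\<in>set (map (\<lambda>((ps, M, Rs), N, vs, xs).
      (N * M, map (\<lambda>(x, R). (dot a x x + N * R) mod (N * M)) (List.product xs Rs))) cs). m mod L \<in> set l"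
    using assms(1) by (intro uncovered_Nil[where K = 1 and rs = "[0]"])
      (auto simp: certificate_def list_all_iff split: prod.splits)
  then obtain cc where cc: "cc \<in> set cs" and hit: "case cc of ((ps, M, Rs), N, vs, xs) \<Rightarrow>
      m mod (N * M) \<in> (\<lambda>(x, R). (dot a x x + N * R) mod (N * M)) ` (set xs \<times> set Rs)"
    by fastforce
  obtain ps M Rs N vs xs where cc_eq: "cc = ((ps, M, Rs), N, vs, xs)" by (metis prod.exhaust)
  from hit obtain x R where x: "x \<in> set xs" "R \<in> set Rs"
      "m mod (N * M) = (dot a x x + N * R) mod (N * M)"
    unfolding cc_eq by auto
  have v: "pattern (ps, M, Rs)" "N > 0" "M > 0" "0 \<le> R" "R < M" "frame a N ps vs"
      "length x = length a" "list_all (\<lambda>v. dot a x v = 0) vs" "dot a x x \<le> B"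
    using assms(1) cc x(1,2) patterns unfolding cc_eq certificate_def
    by (auto simp: list_all_iff split: prod.splits)
  have "N * M dvd m - (dot a x x + N * R)" using x(3) by (simp add: mod_eq_dvd_iff)
  then obtain k where k: "m - (dot a x x + N * R) = N * M * k" by (elim dvdE)
  then have eq: "m = dot a x x + N * (M * k + R)" by (simp add: algebra_simps)
  \<comment> \<open>The purpose of the bound \<open>B\<close>: the patterns represent positive
    numbers only.\<close>
  have "N * (M * k + R) > 0" using eq v(9) assms(2) by simp
  then have "M * k + R > 0" using v(2) by (simp add: zero_less_mult_iff)
  moreover have "(M * k + R) mod M \<in> set Rs" using v(4,5) x(2) by simp
  ultimately have "represents ps (M * k + R)" using v(1) unfolding pattern_def by auto
  from represents_frame[OF v(6-8) this] show ?thesis unfolding eq .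
qed

text \<open>Backtracking with coordinates 0 to 6; a negative remainder ends a branch. Only success
  is informative, since larger coordinates are not tried.\<close>

fun search :: "int list \<Rightarrow> int \<Rightarrow> bool" where
  "search [] m \<longleftrightarrow> m = 0"
| "search (c # a) m \<longleftrightarrow> m = 0 \<or> m > 0 \<and> list_ex (\<lambda>x. search a (m - c * (x * x))) [6, 5, 4, 3, 2, 1, 0]"

lemma search_imp_represents: "search a m \<Longrightarrow> represents a m"
proof (induction a m rule: search.induct)
  case (2 c a m)
  then consider "m = 0" | x where "search a (m - c * (x * x))" "x \<in> set [6, 5, 4, 3, 2, 1, 0]" "m > 0" "m \<noteq> 0"
    unfolding search.simps list_ex_iff by blast
  then show ?case
  proof cases
    case 1 then show ?thesis using represents_subseq[of "[]" "c # a" 0] by simp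
  next
    case 2
    then have "represents a (m - c * (x * x))" 
      using "2.IH" by blast
    then show ?thesis by (auto simp: represents_Cons power2_eq_square)
  qed
qed simp

lemma represents_snoc: "represents (a @ [c]) m \<longleftrightarrow> (\<exists>x. represents a (m - c * x\<^sup>2))"
proof (induction a arbitrary: m)
  case (Cons d a)
  have "m - d * y\<^sup>2 - c * x\<^sup>2 = m - c * x\<^sup>2 - d * y\<^sup>2" for x y by simp
  then show ?case unfolding append_Cons represents_Cons Cons by (metis (no_types))
qed (simp add: represents_Cons)

lemma represents_rev: "represents (rev a) m \<longleftrightarrow> represents a m"
  by (induction a arbitrary: m) (auto simp: represents_snoc represents_Cons)

text \<open>Values up to \<open>B\<close> are searched, larger ones are certified. The exceptions
  \<open>es\<close> allow for \<open>2 * n\<close>, which \<open>[n..2 * n - 1]\<close> does not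
  represent.\<close>

lemma represents_if_certificate:
  assumes "certificate a B cs"
    and "list_all (\<lambda>m. m \<in> set es \<or> search (rev a) m) [l..B]"
    and "l \<le> m" "m \<notin> set es"
  shows "represents a m"
proof (cases "m \<le> B")
  case True
  then have "search (rev a) m" using assms by (auto simp: list_all_iff)
  then show ?thesis using search_imp_represents represents_rev by blast
next
  case False
  then show ?thesis using represents_certificate[OF assms(1)] by simp
qed

section \<open>Certificates for small $n$\<close>

text \<open>In every certificate \<open>B\<close> is the largest norm of a correction vector, here 5
  * 49 + 7 * 25 + 8. The coordinates -7, -5 lie in the plane of a frame vector: (7, 5) is orthogonal
  to (1, -1) in the lattice with entries 5, 7.\<close>

lemma certificate_X_4: "certificate [4..8] 428
     [(([1, 2, 6], 4, [3]), 4, [[1, 0, 0, 0, 0], [0, 0, 0, 0, 1], [0, 0, 2, 0, 0]],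
        [[0, 0, 0, 0, 0], [0, 1, 0, 0, 0], [0, 0, 0, 1, 0], [0, 1, 0, 1, 0], [0, 2, 0, 0, 0],
         [0, 2, 0, 1, 0], [0, 1, 0, 2, 0], [0, 3, 0, 0, 0], [0, 0, 0, 3, 0], [0, 3, 0, 2, 0],
         [0, 2, 0, 3, 0]]),
      (([2, 3, 6], 12, [5, 9]), 2, [[1, 0, 0, 0, 0], [0, 0, 1, 0, 0], [0, 1, 0, -1, 0]],
        [[0, 0, 0, 0, 0], [0, 0, 0, 0, 1], [0, -7, 0, -5, 0], [0, -7, 0, -5, 1]]),
      (([2, 3, 6], 12, [5, 9]), 4, [[0, 0, 0, 0, 1], [0, 1, 0, -1, 0], [0, 0, 2, 0, 0]],
        [[0, 0, 0, 0, 0], [2, 0, 0, 0, 0]])]"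
  by code_simp

lemma represents_X_4: "4 \<le> m \<Longrightarrow> represents [4..8] m"
  by (rule represents_if_certificate[where es = "[]" and l = 4, OF certificate_X_4], code_simp) simp_all

text \<open>The repeated entry 4 provides the orthogonal vectors (1, -2) and (2, 1) of norm 20,
  which together with the entry 5 span 5 times the form with coefficients 1, 4, 4. The entries 6 and
  7 supply all residues modulo 20.\<close>

lemma certificate_Y_4: "certificate (4 # [4..7]) 325
     [(([1, 4, 4], 4, [1]), 5, [[0, 0, 1, 0, 0], [1, -2, 0, 0, 0], [2, 1, 0, 0, 0]],
        [[0, 0, 0, 0, 0], [0, 0, 0, 1, 0], [0, 0, 0, 0, 1], [0, 0, 0, 1, 1], [0, 0, 0, 2, 0],
         [0, 0, 0, 0, 2], [0, 0, 0, 2, 1], [0, 0, 0, 1, 2], [0, 0, 0, 2, 2], [0, 0, 0, 3, 1],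
         [0, 0, 0, 0, 3], [0, 0, 0, 1, 3], [0, 0, 0, 3, 2], [0, 0, 0, 4, 0], [0, 0, 0, 3, 3],
         [0, 0, 0, 1, 4], [0, 0, 0, 5, 0], [0, 0, 0, 4, 3], [0, 0, 0, 0, 5], [0, 0, 0, 5, 5]])]"
  by code_simp

lemma represents_Y_4: "4 \<le> m \<Longrightarrow> represents (4 # [4..7]) m"
  by (rule represents_if_certificate[where es = "[]" and l = 4, OF certificate_Y_4], code_simp) simp_all

lemma certificate_X_5: "certificate [5..10] 249
     [(([2, 3, 6], 12, [5, 9]), 3, [[0, 1, 0, 0, 0, 0], [0, 0, 0, 0, 1, 0], [0, 0, 0, 1, 0, -1]],
        [[0, 0, 0, 0, 0, 0], [1, 0, 0, 0, 0, 0], [0, 0, 1, 0, 0, 0], [1, 0, 1, 0, 0, 0], [2, 0, 0, 0, 0, 0],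
         [2, 0, 1, 0, 0, 0], [0, 0, 2, 0, 0, 0], [1, 0, 2, 0, 0, 0], [3, 0, 0, 0, 0, 0], [3, 0, 1, 0, 0, 0],
         [1, 0, 3, 0, 0, 0], [3, 0, 2, 0, 0, 0], [2, 0, 3, 0, 0, 0], [4, 0, 1, 0, 0, 0], [5, 0, 0, 0, 0, 0],
         [4, 0, 3, 0, 0, 0], [3, 0, 4, 0, 0, 0], [0, 0, 5, 0, 0, 0]]),
      (([2, 3, 6], 12, [5, 9]), 4, [[0, 0, 0, 1, 0, 0], [1, 0, -1, 0, 0, 0], [0, 2, 0, 0, 0, 0]],
        [[0, 0, 0, 0, 1, 0], [0, 0, 0, 0, 1, 2], [0, 0, 0, 0, 3, 0], [0, 0, 0, 0, 3, 2]]),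
      (([1, 2, 6], 4, [3]), 8, [[0, 0, 0, 1, 0, 0], [0, 1, 0, 0, 0, -1], [2, 0, -2, 0, 0, 0]],
        [[0, 0, 0, 0, 1, 0], [0, 0, 0, 0, 3, 0], [0, 0, 0, 0, 5, 0], [0, -5, 0, 0, 1, -3]])]"
  by code_simp

lemma represents_X_5: "5 \<le> m \<Longrightarrow> represents [5..10] m"
  by (rule represents_if_certificate[where es = "[]" and l = 5, OF certificate_X_5], code_simp) simp_all

lemma certificate_Y_5: "certificate (5 # [5..9]) 223
     [(([1, 2, 6], 4, [3]), 6, [[0, 0, 1, 0, 0, 0], [1, 0, 0, -1, 0, 0], [0, 0, 0, 0, 0, 2]],
        [[0, 0, 0, 0, 0, 0], [0, 1, 0, 0, 0, 0], [0, 0, 0, 0, 1, 0], [0, 1, 0, 0, 1, 0], [0, 2, 0, 0, 0, 0],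
         [0, 2, 0, 0, 1, 0], [0, 3, 0, 0, 0, 0], [0, 4, 0, 0, 1, 0], [0, 6, 0, 0, 0, 0]]),
      (([2, 3, 6], 12, [5, 9]), 4, [[0, 0, 0, 0, 1, 0], [1, 0, 0, -1, 0, 0], [0, 0, 2, 0, 0, 0]],
        [[0, 0, 0, 0, 0, 0], [0, 1, 0, 0, 0, 0], [0, 0, 0, 0, 0, 1], [0, 2, 0, 0, 0, 0], [0, 2, 0, 0, 0, 1],
         [0, 0, 0, 0, 0, 2], [0, 1, 0, 0, 0, 2], [0, 3, 0, 0, 0, 0], [0, 2, 0, 0, 0, 2], [0, 4, 0, 0, 0, 0],
         [0, 0, 0, 0, 0, 3], [0, 4, 0, 0, 0, 3], [0, 6, 0, 0, 0, 2]]),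
      (([2, 3, 6], 12, [5, 9]), 12, [[0, 0, 2, 0, 0, 0], [0, 0, 0, 0, 0, 2], [0, 0, 0, 0, 3, 0]],
        [[0, 0, 0, 1, 0, 0], [0, 2, 0, 0, 0, 0], [0, 3, 0, 0, 0, 0], [2, 2, 0, 1, 0, 0], [0, 3, 0, 1, 0, 0],
         [0, 0, 0, 3, 0, 0], [0, 1, 0, 3, 0, 0], [0, 4, 0, 1, 0, 0], [2, 3, 0, 2, 0, 0], [2, 4, 0, 0, 0, 0],
         [2, 2, 0, 3, 0, 0], [0, 2, 0, 4, 0, 0], [0, 4, 0, 3, 0, 0], [4, 4, 0, 1, 0, 0], [0, 0, 0, 5, 0, 0],
         [0, 1, 0, 5, 0, 0], [2, 2, 0, 5, 0, 0], [4, 4, 0, 3, 0, 0]]),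
      (([1, 5, 5], 20, [1, 5, 9]), 8, [[0, 0, 0, 0, 1, 0], [2, -2, 0, 0, 0, 0], [2, 2, 0, 0, 0, 0]],
        [[0, 0, 0, 1, 0, 2], [0, 0, 2, 1, 0, 2], [0, 0, 3, 2, 0, 1], [0, 0, 0, 3, 0, 2], [0, 0, 1, 2, 0, 3],
         [0, 0, 2, 3, 0, 2], [0, 0, 4, 1, 0, 2], [0, 0, 3, 2, 0, 3], [0, 0, 5, 2, 0, 1], [0, 0, 0, 5, 0, 2]])]"
  by code_simp

lemma represents_Y_5: "5 \<le> m \<Longrightarrow> represents (5 # [5..9]) m"
  by (rule represents_if_certificate[where es = "[]" and l = 5, OF certificate_Y_5], code_simp) simp_all

lemma certificate_X_6: "certificate [6..12] 61
     [(([1, 2, 6], 4, [3]), 6, [[1, 0, 0, 0, 0, 0, 0], [0, 0, 0, 0, 0, 0, 1], [0, 0, 0, 2, 0, 0, 0]],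
        [[0, 0, 0, 0, 0, 0, 0], [0, 1, 0, 0, 0, 0, 0], [0, 0, 1, 0, 0, 0, 0], [0, 0, 0, 0, 1, 0, 0],
         [0, 0, 0, 0, 0, 1, 0], [0, 1, 1, 0, 0, 0, 0], [0, 1, 0, 0, 1, 0, 0], [0, 0, 1, 0, 1, 0, 0],
         [0, 0, 1, 0, 0, 1, 0], [0, 0, 0, 0, 1, 1, 0], [0, 1, 1, 0, 1, 0, 0], [0, 1, 1, 0, 0, 1, 0],
         [0, 1, 0, 0, 1, 1, 0], [0, 0, 1, 0, 1, 1, 0], [0, 1, 1, 0, 1, 1, 0], [0, 2, 0, 0, 1, 0, 0],
         [0, 0, 0, 0, 2, 0, 0], [0, 0, 0, 0, 0, 2, 0], [0, 2, 1, 0, 1, 0, 0], [0, 1, 0, 0, 2, 0, 0],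
         [0, 0, 0, 0, 2, 1, 0], [0, 0, 0, 0, 1, 2, 0], [0, 2, 1, 0, 1, 1, 0], [0, 1, 0, 0, 1, 2, 0]])]"
  by code_simp

lemma represents_X_6: "6 \<le> m \<Longrightarrow> represents [6..12] m"
  by (rule represents_if_certificate[where es = "[]" and l = 6, OF certificate_X_6], code_simp) simp_all

lemma certificate_Y_6: "certificate (6 # [6..11]) 82
     [(([2, 3, 6], 12, [5, 9]), 3, [[1, 0, 0, 0, 0, 0, 0], [0, 0, 0, 0, 1, 0, 0], [0, 0, 0, 1, 0, -1, 0]],
        [[0, 0, 0, 0, 0, 0, 0], [0, 1, 0, 0, 0, 0, 0], [0, 0, 1, 0, 0, 0, 0], [0, 0, 0, 0, 0, 0, 1],
         [0, 1, 1, 0, 0, 0, 0], [0, 1, 0, 0, 0, 0, 1], [0, 0, 1, 0, 0, 0, 1], [0, 1, 1, 0, 0, 0, 1],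
         [0, 0, 2, 0, 0, 0, 0], [0, 2, 1, 0, 0, 0, 0], [0, 1, 2, 0, 0, 0, 0], [0, 2, 0, 0, 0, 0, 1],
         [0, 0, 2, 0, 0, 0, 1], [0, 0, 0, 0, 0, 0, 2], [0, 1, 2, 0, 0, 0, 1], [0, 1, 0, 0, 0, 0, 2],
         [0, 0, 1, 0, 0, 0, 2], [0, 2, 2, 0, 0, 0, 0], [0, 1, 1, 0, 0, 0, 2], [0, 3, 1, 0, 0, 0, 0],
         [0, 3, 0, 0, 0, 0, 1], [0, 2, 0, 0, 0, 0, 2], [0, 0, 3, 0, 0, 0, 1], [0, 3, 2, 0, 0, 0, 0]])]"
  by code_simp

lemma represents_Y_6: "6 \<le> m \<Longrightarrow> represents (6 # [6..11]) m"
  by (rule represents_if_certificate[where es = "[]" and l = 6, OF certificate_Y_6], code_simp) simp_all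

text \<open>From here on a certificate concerns the common part \<open>[n..2 * n - 1]\<close> and
  serves both \<open>X n\<close> and \<open>Y n\<close>.\<close>

lemma certificate_Z_7: "certificate [7..13] 188
     [(([2, 3, 6], 12, [5, 9]), 4, [[0, 1, 0, 0, 0, 0, 0], [0, 0, 0, 0, 0, 1, 0], [0, 0, 0, 0, 1, 0, -1]],
        [[0, 0, 0, 0, 0, 0, 0], [1, 0, 0, 0, 0, 0, 0], [0, 0, 1, 0, 0, 0, 0], [0, 0, 0, 1, 0, 0, 0],
         [1, 0, 1, 0, 0, 0, 0], [1, 0, 0, 1, 0, 0, 0], [0, 0, 1, 1, 0, 0, 0], [1, 0, 1, 1, 0, 0, 0],
         [2, 0, 0, 0, 0, 0, 0], [0, 0, 2, 0, 0, 0, 0], [2, 0, 1, 0, 0, 0, 0], [2, 0, 0, 1, 0, 0, 0],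
         [0, 0, 0, 2, 0, 0, 0], [1, 0, 2, 0, 0, 0, 0], [0, 0, 2, 1, 0, 0, 0], [1, 0, 0, 2, 0, 0, 0],
         [0, 0, 1, 2, 0, 0, 0], [1, 0, 2, 1, 0, 0, 0], [1, 0, 1, 2, 0, 0, 0], [3, 0, 0, 0, 0, 0, 0],
         [2, 0, 0, 2, 0, 0, 0], [3, 0, 0, 1, 0, 0, 0], [2, 0, 1, 2, 0, 0, 0], [3, 0, 1, 1, 0, 0, 0],
         [1, 0, 2, 2, 0, 0, 0], [1, 0, 3, 1, 0, 0, 0], [2, 0, 3, 0, 0, 0, 0], [2, 0, 0, 3, 0, 0, 0],
         [2, 0, 3, 1, 0, 0, 0], [0, 0, 2, 3, 0, 0, 0], [0, 0, 3, 3, 0, 0, 0], [2, 0, 0, 4, 0, 0, 0]])]"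
  by code_simp

lemma represents_Z_7: "7 \<le> m \<Longrightarrow> m \<noteq> 14 \<Longrightarrow> represents [7..13] m"
  by (rule represents_if_certificate[where es = "[14]" and l = 7, OF certificate_Z_7], code_simp) simp_all

lemma certificate_Z_8: "certificate [8..15] 90
     [(([2, 3, 6], 12, [5, 9]), 4, [[1, 0, 0, 0, 0, 0, 0, 0], [0, 0, 0, 0, 1, 0, 0, 0], [0, 1, 0, 0, 0, 0, 0, -1]],
        [[0, 0, 0, 0, 0, 0, 0, 0], [0, 0, 1, 0, 0, 0, 0, 0], [0, 0, 0, 1, 0, 0, 0, 0],
         [0, 0, 0, 0, 0, 1, 0, 0], [0, 0, 0, 0, 0, 0, 1, 0], [0, 0, 1, 1, 0, 0, 0, 0],
         [0, 0, 1, 0, 0, 1, 0, 0], [0, 0, 0, 1, 0, 1, 0, 0], [0, 0, 0, 1, 0, 0, 1, 0],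
         [0, 0, 0, 0, 0, 1, 1, 0], [0, 0, 1, 1, 0, 1, 0, 0], [0, 0, 1, 1, 0, 0, 1, 0],
         [0, 0, 1, 0, 0, 1, 1, 0], [0, 0, 0, 1, 0, 1, 1, 0], [0, 0, 2, 0, 0, 0, 0, 0],
         [0, 0, 0, 2, 0, 0, 0, 0], [0, 0, 2, 1, 0, 0, 0, 0], [0, 0, 0, 0, 0, 2, 0, 0],
         [0, 0, 1, 2, 0, 0, 0, 0], [0, 0, 0, 2, 0, 1, 0, 0], [0, 0, 0, 1, 0, 2, 0, 0],
         [0, 0, 2, 1, 0, 1, 0, 0], [0, 0, 2, 1, 0, 0, 1, 0], [0, 0, 0, 0, 0, 2, 1, 0],
         [0, 0, 1, 2, 0, 0, 1, 0], [0, 0, 1, 0, 0, 2, 1, 0], [0, 0, 0, 1, 0, 2, 1, 0],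
         [0, 0, 2, 1, 0, 1, 1, 0], [0, 0, 1, 0, 0, 1, 2, 0], [0, 0, 1, 2, 0, 1, 1, 0],
         [0, 0, 1, 1, 0, 2, 1, 0], [0, 0, 1, 1, 0, 1, 2, 0]])]"
  by code_simp

lemma represents_Z_8: "8 \<le> m \<Longrightarrow> m \<noteq> 16 \<Longrightarrow> represents [8..15] m"
  by (rule represents_if_certificate[where es = "[16]" and l = 8, OF certificate_Z_8], code_simp) simp_all

text \<open>From \<open>n = 9\<close> on the form represents all positive integers, so one
  correction vector for each residue modulo \<open>N\<close> is enough. The frame norms here are 14,
  13 + 15, 11 + 17 and 4 * 10 + 16.\<close>

lemma certificate_Z_9: "certificate [9..17] 237
     [(([1, 2, 2, 4], 1, [0]), 14, [[0, 0, 0, 0, 0, 1, 0, 0, 0], [0, 0, 0, 0, 1, 0, 1, 0, 0],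
 [0, 0, 1, 0, 0, 0, 0, 0, 1], [0, 2, 0, 0, 0, 0, 0, 1, 0]],
        [[0, 0, 0, 0, 0, 0, 0, 0, 0], [1, 0, 0, 0, 0, 0, 0, 0, 0], [0, 0, 0, 1, 0, 0, 0, 0, 0],
         [1, 0, 0, 1, 0, 0, 0, 0, 0], [2, 0, 0, 0, 0, 0, 0, 0, 0], [0, 0, 0, 2, 0, 0, 0, 0, 0],
         [1, 0, 0, 2, 0, 0, 0, 0, 0], [3, 0, 0, 0, 0, 0, 0, 0, 0], [0, 0, 0, 3, 0, 0, 0, 0, 0],
         [1, 0, 0, 3, 0, 0, 0, 0, 0], [3, 0, 0, 2, 0, 0, 0, 0, 0], [2, 0, 0, 3, 0, 0, 0, 0, 0],
         [4, 0, 0, 1, 0, 0, 0, 0, 0], [5, 0, 0, 1, 0, 0, 0, 0, 0]])]"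
  by code_simp

lemma represents_Z_9: "9 \<le> m \<Longrightarrow> m \<noteq> 18 \<Longrightarrow> represents [9..17] m"
  by (rule represents_if_certificate[where es = "[18]" and l = 9, OF certificate_Z_9], code_simp) simp_all

lemma certificate_Z_10: "certificate [10..19] 51
     [(([1, 2, 4, 8], 1, [0]), 18, [[0, 0, 0, 0, 0, 0, 0, 0, 1, 0], [0, 0, 0, 0, 0, 0, 0, 1, 0, 1],
 [0, 0, 1, 0, 0, 2, 0, 0, 0, 0], [0, 0, 0, 0, 0, 0, 3, 0, 0, 0]],
        [[0, 0, 0, 0, 0, 0, 0, 0, 0, 0], [1, 0, 0, 0, 0, 0, 0, 0, 0, 0], [0, 1, 0, 0, 0, 0, 0, 0, 0, 0],
         [0, 0, 0, 1, 0, 0, 0, 0, 0, 0], [0, 0, 0, 0, 1, 0, 0, 0, 0, 0], [1, 1, 0, 0, 0, 0, 0, 0, 0, 0],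
         [1, 0, 0, 1, 0, 0, 0, 0, 0, 0], [0, 1, 0, 1, 0, 0, 0, 0, 0, 0], [0, 1, 0, 0, 1, 0, 0, 0, 0, 0],
         [0, 0, 0, 1, 1, 0, 0, 0, 0, 0], [1, 1, 0, 1, 0, 0, 0, 0, 0, 0], [1, 1, 0, 0, 1, 0, 0, 0, 0, 0],
         [1, 0, 0, 1, 1, 0, 0, 0, 0, 0], [0, 1, 0, 1, 1, 0, 0, 0, 0, 0], [2, 0, 0, 0, 0, 0, 0, 0, 0, 0],
         [0, 2, 0, 0, 0, 0, 0, 0, 0, 0], [1, 1, 0, 1, 1, 0, 0, 0, 0, 0], [2, 1, 0, 0, 0, 0, 0, 0, 0, 0]])]"
  by code_simp

lemma represents_Z_10: "10 \<le> m \<Longrightarrow> m \<noteq> 20 \<Longrightarrow> represents [10..19] m"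
  by (rule represents_if_certificate[where es = "[20]" and l = 10, OF certificate_Z_10], code_simp) simp_all

lemma certificate_Z_11: "certificate [11..21] 58
     [(([1, 2, 4, 8], 1, [0]), 18, [[0, 0, 0, 0, 0, 0, 0, 1, 0, 0, 0], [0, 0, 0, 0, 0, 0, 1, 0, 1, 0, 0],
 [0, 1, 0, 0, 2, 0, 0, 0, 0, 0, 0], [0, 0, 0, 0, 0, 3, 0, 0, 0, 0, 0]],
        [[0, 0, 0, 0, 0, 0, 0, 0, 0, 0, 0], [1, 0, 0, 0, 0, 0, 0, 0, 0, 0, 0],
         [0, 0, 1, 0, 0, 0, 0, 0, 0, 0, 0], [0, 0, 0, 1, 0, 0, 0, 0, 0, 0, 0],
         [0, 0, 0, 0, 0, 0, 0, 0, 0, 1, 0], [0, 0, 0, 0, 0, 0, 0, 0, 0, 0, 1],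
         [1, 0, 1, 0, 0, 0, 0, 0, 0, 0, 0], [1, 0, 0, 1, 0, 0, 0, 0, 0, 0, 0],
         [0, 0, 1, 1, 0, 0, 0, 0, 0, 0, 0], [0, 0, 1, 0, 0, 0, 0, 0, 0, 1, 0],
         [0, 0, 0, 1, 0, 0, 0, 0, 0, 1, 0], [0, 0, 0, 1, 0, 0, 0, 0, 0, 0, 1],
         [0, 0, 0, 0, 0, 0, 0, 0, 0, 1, 1], [1, 0, 1, 0, 0, 0, 0, 0, 0, 1, 0],
         [1, 0, 0, 1, 0, 0, 0, 0, 0, 0, 1], [0, 0, 1, 1, 0, 0, 0, 0, 0, 0, 1],
         [0, 0, 0, 1, 0, 0, 0, 0, 0, 1, 1], [1, 0, 1, 1, 0, 0, 0, 0, 0, 1, 0]])]"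
  by code_simp

lemma represents_Z_11: "11 \<le> m \<Longrightarrow> m \<noteq> 22 \<Longrightarrow> represents [11..21] m"
  by (rule represents_if_certificate[where es = "[22]" and l = 11, OF certificate_Z_11], code_simp) simp_all

lemma certificate_Z_12: "certificate [12..23] 60
     [(([1, 2, 4, 8], 1, [0]), 13, [[0, 1, 0, 0, 0, 0, 0, 0, 0, 0, 0, 0], [1, 0, 1, 0, 0, 0, 0, 0, 0, 0, 0, 0],
 [0, 0, 0, 0, 1, 1, 0, 1, 0, 0, 0, 0], [0, 0, 0, 0, 0, 0, 0, 0, 1, 2, 0, 0]],
        [[0, 0, 0, 0, 0, 0, 0, 0, 0, 0, 0, 0], [0, 0, 0, 1, 0, 0, 0, 0, 0, 0, 0, 0],
         [0, 0, 0, 0, 0, 0, 1, 0, 0, 0, 0, 0], [0, 0, 0, 0, 0, 0, 0, 0, 0, 0, 1, 0],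
         [0, 0, 0, 0, 0, 0, 0, 0, 0, 0, 0, 1], [0, 0, 0, 1, 0, 0, 1, 0, 0, 0, 0, 0],
         [0, 0, 0, 1, 0, 0, 0, 0, 0, 0, 1, 0], [0, 0, 0, 1, 0, 0, 0, 0, 0, 0, 0, 1],
         [0, 0, 0, 0, 0, 0, 1, 0, 0, 0, 1, 0], [0, 0, 0, 0, 0, 0, 0, 0, 0, 0, 1, 1],
         [0, 0, 0, 1, 0, 0, 1, 0, 0, 0, 1, 0], [0, 0, 0, 1, 0, 0, 1, 0, 0, 0, 0, 1],
         [0, 0, 0, 1, 0, 0, 0, 0, 0, 0, 1, 1]])]"
  by code_simp

lemma represents_Z_12: "12 \<le> m \<Longrightarrow> m \<noteq> 24 \<Longrightarrow> represents [12..23] m"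
  by (rule represents_if_certificate[where es = "[24]" and l = 12, OF certificate_Z_12], code_simp) simp_all

lemma certificate_Z_13: "certificate [13..25] 52
     [(([1, 2, 4, 8], 1, [0]), 18, [[0, 0, 0, 0, 0, 1, 0, 0, 0, 0, 0, 0, 0],
 [0, 0, 0, 0, 1, 0, 1, 0, 0, 0, 0, 0, 0], [2, 0, 0, 0, 0, 0, 0, 1, 0, 0, 0, 0, 0],
 [0, 0, 0, 3, 0, 0, 0, 0, 0, 0, 0, 0, 0]],
        [[0, 0, 0, 0, 0, 0, 0, 0, 0, 0, 0, 0, 0], [0, 1, 0, 0, 0, 0, 0, 0, 0, 0, 0, 0, 0],
         [0, 0, 1, 0, 0, 0, 0, 0, 0, 0, 0, 0, 0], [0, 0, 0, 0, 0, 0, 0, 0, 1, 0, 0, 0, 0],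
         [0, 0, 0, 0, 0, 0, 0, 0, 0, 1, 0, 0, 0], [0, 0, 0, 0, 0, 0, 0, 0, 0, 0, 1, 0, 0],
         [0, 0, 0, 0, 0, 0, 0, 0, 0, 0, 0, 1, 0], [0, 0, 0, 0, 0, 0, 0, 0, 0, 0, 0, 0, 1],
         [0, 1, 1, 0, 0, 0, 0, 0, 0, 0, 0, 0, 0], [0, 1, 0, 0, 0, 0, 0, 0, 1, 0, 0, 0, 0],
         [0, 0, 1, 0, 0, 0, 0, 0, 0, 1, 0, 0, 0], [0, 0, 1, 0, 0, 0, 0, 0, 0, 0, 1, 0, 0],
         [0, 0, 0, 0, 0, 0, 0, 0, 1, 0, 1, 0, 0], [0, 0, 0, 0, 0, 0, 0, 0, 0, 1, 1, 0, 0],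
         [0, 0, 0, 0, 0, 0, 0, 0, 0, 1, 0, 1, 0], [0, 0, 0, 0, 0, 0, 0, 0, 0, 0, 1, 0, 1],
         [0, 0, 0, 0, 0, 0, 0, 0, 0, 0, 0, 1, 1], [0, 1, 1, 0, 0, 0, 0, 0, 0, 0, 1, 0, 0]])]"
  by code_simp

lemma represents_Z_13: "13 \<le> m \<Longrightarrow> m \<noteq> 26 \<Longrightarrow> represents [13..25] m"
  by (rule represents_if_certificate[where es = "[26]" and l = 13, OF certificate_Z_13], code_simp) simp_all

lemma certificate_Z_14: "certificate [14..27] 49
     [(([1, 2, 4, 8], 1, [0]), 18, [[0, 0, 0, 0, 1, 0, 0, 0, 0, 0, 0, 0, 0, 0],
 [0, 0, 0, 1, 0, 1, 0, 0, 0, 0, 0, 0, 0, 0], [0, 0, 0, 0, 0, 0, 0, 0, 0, 1, 1, 1, 0, 0],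
 [0, 0, 3, 0, 0, 0, 0, 0, 0, 0, 0, 0, 0, 0]],
        [[0, 0, 0, 0, 0, 0, 0, 0, 0, 0, 0, 0, 0, 0], [1, 0, 0, 0, 0, 0, 0, 0, 0, 0, 0, 0, 0, 0],
         [0, 1, 0, 0, 0, 0, 0, 0, 0, 0, 0, 0, 0, 0], [0, 0, 0, 0, 0, 0, 1, 0, 0, 0, 0, 0, 0, 0],
         [0, 0, 0, 0, 0, 0, 0, 1, 0, 0, 0, 0, 0, 0], [0, 0, 0, 0, 0, 0, 0, 0, 1, 0, 0, 0, 0, 0],
         [0, 0, 0, 0, 0, 0, 0, 0, 0, 0, 0, 0, 1, 0], [0, 0, 0, 0, 0, 0, 0, 0, 0, 0, 0, 0, 0, 1],
         [1, 1, 0, 0, 0, 0, 0, 0, 0, 0, 0, 0, 0, 0], [1, 0, 0, 0, 0, 0, 1, 0, 0, 0, 0, 0, 0, 0],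
         [0, 1, 0, 0, 0, 0, 1, 0, 0, 0, 0, 0, 0, 0], [0, 1, 0, 0, 0, 0, 0, 0, 1, 0, 0, 0, 0, 0],
         [0, 0, 0, 0, 0, 0, 1, 1, 0, 0, 0, 0, 0, 0], [0, 0, 0, 0, 0, 0, 1, 0, 1, 0, 0, 0, 0, 0],
         [0, 0, 0, 0, 0, 0, 0, 1, 1, 0, 0, 0, 0, 0], [0, 0, 0, 0, 0, 0, 1, 0, 0, 0, 0, 0, 1, 0],
         [0, 0, 0, 0, 0, 0, 0, 0, 1, 0, 0, 0, 1, 0], [0, 0, 0, 0, 0, 0, 0, 0, 1, 0, 0, 0, 0, 1]])]"
  by code_simp

lemma represents_Z_14: "14 \<le> m \<Longrightarrow> m \<noteq> 28 \<Longrightarrow> represents [14..27] m"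
  by (rule represents_if_certificate[where es = "[28]" and l = 14, OF certificate_Z_14], code_simp) simp_all

lemma certificate_Z_15: "certificate [15..29] 50
     [(([1, 2, 4, 8], 1, [0]), 17, [[0, 0, 1, 0, 0, 0, 0, 0, 0, 0, 0, 0, 0, 0, 0],
 [0, 1, 0, 1, 0, 0, 0, 0, 0, 0, 0, 0, 0, 0, 0], [0, 0, 0, 0, 0, 0, 1, 1, 0, 0, 1, 0, 0, 0, 0],
 [0, 0, 0, 0, 0, 0, 0, 0, 0, 1, 0, 0, 0, 2, 0]],
        [[0, 0, 0, 0, 0, 0, 0, 0, 0, 0, 0, 0, 0, 0, 0], [1, 0, 0, 0, 0, 0, 0, 0, 0, 0, 0, 0, 0, 0, 0],
         [0, 0, 0, 0, 1, 0, 0, 0, 0, 0, 0, 0, 0, 0, 0], [0, 0, 0, 0, 0, 1, 0, 0, 0, 0, 0, 0, 0, 0, 0],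
         [0, 0, 0, 0, 0, 0, 0, 0, 1, 0, 0, 0, 0, 0, 0], [0, 0, 0, 0, 0, 0, 0, 0, 0, 0, 0, 1, 0, 0, 0],
         [0, 0, 0, 0, 0, 0, 0, 0, 0, 0, 0, 0, 1, 0, 0], [0, 0, 0, 0, 0, 0, 0, 0, 0, 0, 0, 0, 0, 0, 1],
         [1, 0, 0, 0, 0, 1, 0, 0, 0, 0, 0, 0, 0, 0, 0], [1, 0, 0, 0, 0, 0, 0, 0, 1, 0, 0, 0, 0, 0, 0],
         [0, 0, 0, 0, 1, 1, 0, 0, 0, 0, 0, 0, 0, 0, 0], [1, 0, 0, 0, 0, 0, 0, 0, 0, 0, 0, 1, 0, 0, 0],
         [0, 0, 0, 0, 1, 0, 0, 0, 1, 0, 0, 0, 0, 0, 0], [0, 0, 0, 0, 1, 0, 0, 0, 0, 0, 0, 1, 0, 0, 0],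
         [0, 0, 0, 0, 0, 1, 0, 0, 0, 0, 0, 0, 1, 0, 0], [0, 0, 0, 0, 1, 0, 0, 0, 0, 0, 0, 0, 0, 0, 1],
         [0, 0, 0, 0, 0, 0, 0, 0, 1, 0, 0, 0, 1, 0, 0]])]"
  by code_simp

lemma represents_Z_15: "15 \<le> m \<Longrightarrow> m \<noteq> 30 \<Longrightarrow> represents [15..29] m"
  by (rule represents_if_certificate[where es = "[30]" and l = 15, OF certificate_Z_15], code_simp) simp_all

lemma certificate_Z_16: "certificate [16..31] 53
     [(([1, 2, 4, 8], 1, [0]), 17, [[0, 1, 0, 0, 0, 0, 0, 0, 0, 0, 0, 0, 0, 0, 0, 0],
 [1, 0, 1, 0, 0, 0, 0, 0, 0, 0, 0, 0, 0, 0, 0, 0], [0, 0, 0, 1, 0, 0, 0, 0, 1, 1, 0, 0, 0, 0, 0, 0],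
 [0, 0, 0, 0, 0, 0, 0, 0, 0, 0, 0, 2, 1, 0, 0, 0]],
        [[0, 0, 0, 0, 0, 0, 0, 0, 0, 0, 0, 0, 0, 0, 0, 0], [0, 0, 0, 0, 1, 0, 0, 0, 0, 0, 0, 0, 0, 0, 0, 0],
         [0, 0, 0, 0, 0, 1, 0, 0, 0, 0, 0, 0, 0, 0, 0, 0], [0, 0, 0, 0, 0, 0, 1, 0, 0, 0, 0, 0, 0, 0, 0, 0],
         [0, 0, 0, 0, 0, 0, 0, 1, 0, 0, 0, 0, 0, 0, 0, 0], [0, 0, 0, 0, 0, 0, 0, 0, 0, 0, 1, 0, 0, 0, 0, 0],
         [0, 0, 0, 0, 0, 0, 0, 0, 0, 0, 0, 0, 0, 1, 0, 0], [0, 0, 0, 0, 0, 0, 0, 0, 0, 0, 0, 0, 0, 0, 1, 0],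
         [0, 0, 0, 0, 0, 0, 0, 0, 0, 0, 0, 0, 0, 0, 0, 1], [0, 0, 0, 0, 1, 1, 0, 0, 0, 0, 0, 0, 0, 0, 0, 0],
         [0, 0, 0, 0, 1, 0, 1, 0, 0, 0, 0, 0, 0, 0, 0, 0], [0, 0, 0, 0, 0, 1, 0, 1, 0, 0, 0, 0, 0, 0, 0, 0],
         [0, 0, 0, 0, 0, 0, 1, 1, 0, 0, 0, 0, 0, 0, 0, 0], [0, 0, 0, 0, 0, 0, 0, 1, 0, 0, 1, 0, 0, 0, 0, 0],
         [0, 0, 0, 0, 0, 1, 0, 0, 0, 0, 0, 0, 0, 1, 0, 0], [0, 0, 0, 0, 0, 0, 0, 1, 0, 0, 0, 0, 0, 1, 0, 0],
         [0, 0, 0, 0, 0, 0, 0, 1, 0, 0, 0, 0, 0, 0, 1, 0]])]"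
  by code_simp

lemma represents_Z_16: "16 \<le> m \<Longrightarrow> m \<noteq> 32 \<Longrightarrow> represents [16..31] m"
  by (rule represents_if_certificate[where es = "[32]" and l = 16, OF certificate_Z_16], code_simp) simp_all

lemma represents_Z_small:
  assumes "7 \<le> n" "n \<le> 16" "n \<le> m" "m \<noteq> 2 * n"
  shows "represents [n..2 * n - 1] m"
proof -
  have "n = 7 \<or> n = 8 \<or> n = 9 \<or> n = 10 \<or> n = 11 \<or> n = 12 \<or> n = 13 \<or> n = 14 \<or> n = 15 \<or> n = 16"
    using assms(1,2) by presburger
  then show ?thesis
    using assms represents_Z_7 represents_Z_8 represents_Z_9 represents_Z_10 represents_Z_11 represents_Z_12
      represents_Z_13 represents_Z_14 represents_Z_15 represents_Z_16
    by (elim disjE) simp_all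
qed

lemma represents_XY_small:
  assumes "4 \<le> n" "n \<le> 6" "n \<le> m"
  shows "represents (X n) m" "represents (Y n) m"
proof -
  have "n \<in> {4, 5, 6}" using assms by auto
  then show "represents (X n) m" "represents (Y n) m"
    using assms represents_X_4 represents_X_5 represents_X_6 represents_Y_4 represents_Y_5 represents_Y_6
    by (auto simp: X_def Y_def)
qed

section \<open>Universality and minimality\<close>

lemma represents_distinct:
  "distinct a \<Longrightarrow> represents a (\<Sum>c\<in>set a. c * (f c)\<^sup>2)"
proof (induction a)
  case (Cons c a)
  show ?case
    unfolding represents_Cons by (rule exI[of _ "f c"]) (use Cons in simp)
qed simp

text \<open>\<open>kv\<close> pairs entries with their coordinates, all others being 0; in this way
  vectors are written down when the rank depends on \<open>n\<close>.\<close>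

lemma represents_upto:
  assumes "distinct (map fst kv)" "fst ` set kv \<subseteq> {l..h}"
  shows "represents [l..h] (\<Sum>(c, x)\<leftarrow>kv. c * x\<^sup>2)"
proof -
  define f where "f c = (case map_of kv c of None \<Rightarrow> 0 | Some x \<Rightarrow> x)" for c
  have "(\<Sum>c\<in>{l..h}. c * (f c)\<^sup>2) = (\<Sum>c\<in>fst ` set kv. c * (f c)\<^sup>2)"
    by (rule sum.mono_neutral_right)
      (use assms(2) in \<open>auto simp: f_def map_of_eq_None_iff split: option.splits dest: map_of_SomeD intro!: rev_image_eqI\<close>)
  also have "\<dots> = (\<Sum>c\<leftarrow>map fst kv. c * (f c)\<^sup>2)"
    using sum_list_distinct_conv_sum_set[OF assms(1), of "\<lambda>c. c * (f c)\<^sup>2"] by simp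
  also have "\<dots> = (\<Sum>(c, x)\<leftarrow>kv. c * x\<^sup>2)"
    using assms(1) unfolding map_map
    by (intro arg_cong[where f = sum_list] map_cong) (auto simp: f_def)
  finally show ?thesis using represents_distinct[of "[l..h]" f] by simp
qed

text \<open>The vectors \<open>e\<^sub>n\<^sub>+\<^sub>1\<close>, \<open>e\<^sub>n + e\<^sub>n\<^sub>+\<^sub>2\<close>, \<open>e\<^sub>n\<^sub>+\<^sub>4 + e\<^sub>n\<^sub>+\<^sub>5 + e\<^sub>2\<^sub>n\<^sub>-\<^sub>5\<close> and
  \<open>2 e\<^sub>n\<^sub>+\<^sub>3 + e\<^sub>2\<^sub>n\<^sub>-\<^sub>1 + e\<^sub>2\<^sub>n\<^sub>-\<^sub>3\<close> span \<open>n + 1\<close> times the universal form \<open>\<langle>1, 2, 4, 8\<rangle>\<close>.\<close>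

lemma represents_Z_large_frame:
  fixes n S :: int
  assumes "n \<ge> 17" "S \<ge> 0" "distinct rs" "set rs \<subseteq> {n + 6..2 * n - 6} \<union> {2 * n - 4, 2 * n - 2}"
  shows "represents [n..2 * n - 1] (sum_list rs + (n + 1) * S)"
proof -
  obtain A B C D where S: "S = A\<^sup>2 + 2 * B\<^sup>2 + 4 * C\<^sup>2 + 8 * D\<^sup>2"
    using form_1_2_4_8 assms(2) by blast
  define kv where "kv = [(n + 1, A), (n, B), (n + 2, B), (n + 4, C), (n + 5, C), (2 * n - 5, C),
    (n + 3, 2 * D), (2 * n - 1, D), (2 * n - 3, D)]"
  have "(\<Sum>(c, x)\<leftarrow>kv @ map (\<lambda>c. (c, 1)) rs. c * x\<^sup>2) = (n + 1) * S + sum_list rs"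
    by (simp add: kv_def S power_mult_distrib algebra_simps o_def)
  moreover have "distinct (map fst (kv @ map (\<lambda>c. (c, 1)) rs))"
    using assms by (auto simp: kv_def o_def)
  moreover have "fst ` set (kv @ map (\<lambda>c. (c, 1)) rs) \<subseteq> {n..2 * n - 1}"
    using assms by (auto simp: kv_def)
  ultimately show ?thesis using represents_upto[of "kv @ map (\<lambda>c. (c, 1)) rs" n "2 * n - 1"]
    by (simp add: add.commute)
qed

text \<open>The entry \<open>n + 1 + r\<close> has residue \<open>r\<close> modulo
  \<open>n + 1\<close>. Entries outside the frame cover 5 to \<open>n - 7\<close>,
  \<open>n - 5\<close> and \<open>n - 3\<close> in this way; the other nonzero residues take two
  entries. The bound \<open>3 * n + 7\<close> is attained at \<open>r = 4\<close>, and the pair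
  \<open>n + 6\<close>, \<open>2 * n - 10\<close> is admissible and distinct only from
  \<open>n = 17\<close> on.\<close>

lemma Z_large_residue:
  fixes n r :: int
  assumes "n \<ge> 17" "0 \<le> r" "r \<le> n"
  shows "\<exists>rs j. distinct rs \<and> set rs \<subseteq> {n + 6..2 * n - 6} \<union> {2 * n - 4, 2 * n - 2} \<and>
    sum_list rs = (n + 1) * j + r \<and> sum_list rs \<le> 3 * n + 7"
proof -
  have *: ?thesis if "distinct rs" "set rs \<subseteq> {n + 6..2 * n - 6} \<union> {2 * n - 4, 2 * n - 2}"
    "sum_list rs = (n + 1) * j + r" "sum_list rs \<le> 3 * n + 7" for rs j
    using that by blast
  consider "r = 0" | "1 \<le> r" "r \<le> 4" | "5 \<le> r" "r \<le> n - 7" | "r = n - 5" | "r = n - 3"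
    | "r = n - 6" | "r = n - 4" | "r = n - 2" | "r = n - 1" | "r = n"
    using assms by linarith
  then show ?thesis
  proof cases
    case 1
    show ?thesis by (rule *[of "[]" 0]) (use 1 assms in simp_all)
  next
    case 2
    show ?thesis by (rule *[of "[n + 5 + r, 2 * n - 2]" 3]) (use 2 assms in simp_all)
  next
    case 3
    show ?thesis by (rule *[of "[n + r + 1]" 1]) (use 3 assms in simp_all)
  next
    case 4
    show ?thesis by (rule *[of "[2 * n - 4]" 1]) (use 4 assms in simp_all)
  next
    case 5
    show ?thesis by (rule *[of "[2 * n - 2]" 1]) (use 5 assms in simp_all)
  next
    case 6
    show ?thesis by (rule *[of "[n + 6, 2 * n - 10]" 2]) (use 6 assms in simp_all)
  next
    case 7
    show ?thesis by (rule *[of "[n + 6, 2 * n - 8]" 2]) (use 7 assms in simp_all)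
  next
    case 8
    show ?thesis by (rule *[of "[n + 6, 2 * n - 6]" 2]) (use 8 assms in simp_all)
  next
    case 9
    show ?thesis by (rule *[of "[n + 7, 2 * n - 6]" 2]) (use 9 assms in simp_all)
  next
    case 10
    show ?thesis by (rule *[of "[n + 8, 2 * n - 6]" 2]) (use 10 assms in simp_all)
  qed
qed

text \<open>Sums of two distinct entries fill the range from \<open>2 * n + 1\<close> to
  \<open>4 * n - 3\<close>. Beyond it, a correction of at most \<open>3 * n + 7\<close> fits below
  \<open>m\<close> and leaves a nonnegative multiple of \<open>n + 1\<close> for the frame.\<close>

lemma represents_Z_large:
  assumes "n \<ge> 17" "m \<ge> n" "m \<noteq> 2 * n"
  shows "represents [n..2 * n - 1] m"
proof -
  consider "m \<le> 2 * n - 1" | "2 * n < m" "m \<le> 3 * n - 1" | "3 * n \<le> m" "m \<le> 4 * n - 3" | "4 * n - 2 \<le> m"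
    using assms by linarith
  then show ?thesis
  proof cases
    case 1
    then show ?thesis using represents_upto[of "[(m, 1)]" n "2 * n - 1"] assms by simp
  next
    case 2
    then show ?thesis using represents_upto[of "[(n, 1), (m - n, 1)]" n "2 * n - 1"] assms by simp
  next
    case 3
    then show ?thesis
      using represents_upto[of "[(m - (2 * n - 1), 1), (2 * n - 1, 1)]" n "2 * n - 1"] assms by simp
  next
    case 4
    obtain rs j where rs: "distinct rs" "set rs \<subseteq> {n + 6..2 * n - 6} \<union> {2 * n - 4, 2 * n - 2}"
      "sum_list rs = (n + 1) * j + m mod (n + 1)" "sum_list rs \<le> 3 * n + 7"
      using Z_large_residue[of n "m mod (n + 1)"] assms(1) pos_mod_bound[of "n + 1" m] by auto
    have "m = (n + 1) * (m div (n + 1)) + m mod (n + 1)" by simp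
    then have m: "m = sum_list rs + (n + 1) * (m div (n + 1) - j)"
      using rs(3) by (simp add: right_diff_distrib)
    then have "(n + 1) * (m div (n + 1) - j) \<ge> 0" using 4 rs(4) assms(1) by linarith
    then have "m div (n + 1) - j \<ge> 0" using assms(1) by (simp add: zero_le_mult_iff)
    then show ?thesis using represents_Z_large_frame[OF assms(1) _ rs(1,2)] m by metis
  qed
qed

text \<open>For \<open>n \<ge> 7\<close> only \<open>2 * n\<close> is left by the common part; it is
  an entry of \<open>X n\<close> and the sum of the two entries \<open>n\<close> of
  \<open>Y n\<close>.\<close>

lemma universal_X: "n > 3 \<Longrightarrow> universal n (X n)"
  and universal_Y: "n > 3 \<Longrightarrow> universal n (Y n)"
proof -
  assume "n > 3"
  have Z: "represents [n..2 * n - 1] m" if "n \<ge> 7" "m \<ge> n" "m \<noteq> 2 * n" for m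
    using represents_Z_small[of n m] represents_Z_large[of n m] that by (cases "n \<ge> 17") auto
  have X: "represents (X n) m" and Y: "represents (Y n) m" if "m \<ge> n" for m
  proof -
    have 2: "represents (X n) (2 * n)"
      using represents_upto[of "[(2 * n, 1)]" n "2 * n"] \<open>n > 3\<close> by (simp add: X_def)
    have 3: "represents (Y n) (2 * n)"
      unfolding Y_def represents_Cons
      by (rule exI[of _ 1]) (use represents_upto[of "[(n, 1)]" n "2 * n - 1"] \<open>n > 3\<close> in simp)
    have 4: "subseq [n..2 * n - 1] (X n)" "subseq [n..2 * n - 1] (Y n)"
      using upto_rec2[of n "2 * n"] \<open>n > 3\<close> by (auto simp: X_def Y_def)
    have "4 \<le> n \<and> n \<le> 6 \<or> n \<ge> 7" using \<open>n > 3\<close> by auto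
    then show "represents (X n) m" "represents (Y n) m"
      using represents_XY_small[OF _ _ that] Z[OF _ that] 2 3 represents_subseq[OF 4(1), of m]
        represents_subseq[OF 4(2), of m] by (cases "m = 2 * n"; blast)+
  qed
  show "universal n (X n)" "universal n (Y n)"
    using X Y by (auto simp: universal_def \<T>_def)
qed

section \<open>Small values and minimality\<close>

lemma mult_square_ge:
  assumes "n \<le> c" "0 < (n :: int)" "x \<noteq> 0"
  shows "n \<le> c * x\<^sup>2" "x\<^sup>2 \<noteq> 1 \<Longrightarrow> 4 * n \<le> c * x\<^sup>2"
proof -
  have "x\<^sup>2 \<ge> 1" using \<open>x \<noteq> 0\<close> by (simp add: int_one_le_iff_zero_less)
  then show "n \<le> c * x\<^sup>2" using mult_mono[of n c 1 "x\<^sup>2"] assms by simp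
  assume "x\<^sup>2 \<noteq> 1"
  then have "\<bar>x\<bar> \<ge> 2" using \<open>x \<noteq> 0\<close> by (auto simp: power2_eq_1_iff)
  then have "x\<^sup>2 \<ge> 4" using power_mono[of 2 "\<bar>x\<bar>" 2] by simp
  then show "4 * n \<le> c * x\<^sup>2" using mult_mono[of n c 4 "x\<^sup>2"] assms by (simp add: mult.commute)
qed

lemma represents_lower_bound:
  assumes "represents a m" "\<forall>c\<in>set a. n \<le> c" "n > 0"
  shows "m = 0 \<or> n \<le> m"
  using assms(1,2)
proof (induction a arbitrary: m)
  case (Cons c a)
  then obtain x where x: "represents a (m - c * x\<^sup>2)" by (auto simp: represents_Cons)
  have "m - c * x\<^sup>2 = 0 \<or> n \<le> m - c * x\<^sup>2" using Cons.IH[OF x] Cons.prems by simp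
  moreover have "x = 0 \<or> n \<le> c * x\<^sup>2" using mult_square_ge(1)[of n c x] Cons.prems assms(3) by auto
  ultimately show ?case using assms(3) by auto
qed simp

lemma represents_small:
  assumes "represents a m" "\<forall>c\<in>set a. n \<le> c" "0 < m" "m < 2 * n"
  shows "m \<in> set a"
  using assms
proof (induction a arbitrary: m)
  case (Cons c a)
  obtain x where x: "represents a (m - c * x\<^sup>2)" using Cons.prems by (auto simp: represents_Cons)
  show ?case
  proof (cases "x = 0")
    case True
    then show ?thesis using Cons x by simp
  next
    case False
    have "m - c * x\<^sup>2 = 0 \<or> n \<le> m - c * x\<^sup>2"
      using represents_lower_bound[OF x, of n] Cons.prems by simp
    then show ?thesis using mult_square_ge[of n c x] False Cons.prems by (cases "x\<^sup>2 = 1") auto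
  qed
qed simp

text \<open>A nonzero coordinate either exhausts \<open>2 * n\<close> or leaves at least
  \<open>n\<close>, and in the latter case both contributions are exactly \<open>n\<close>.\<close>

lemma represents_double:
  assumes "represents a (2 * n)" "\<forall>c\<in>set a. n \<le> c" "0 < n"
  shows "2 * n \<in> set a \<or> 2 \<le> count_list a n"
  using assms
proof (induction a)
  case (Cons c a)
  obtain x where x: "represents a (2 * n - c * x\<^sup>2)" using Cons.prems by (auto simp: represents_Cons)
  show ?case
  proof (cases "x = 0")
    case True
    then have "2 * n \<in> set a \<or> 2 \<le> count_list a n" using Cons x by simp
    moreover have "count_list a n \<le> count_list (c # a) n" by simp
    ultimately show ?thesis by (meson le_trans list.set_intros(2))
  next
    case False
    have "2 * n - c * x\<^sup>2 = 0 \<or> n \<le> 2 * n - c * x\<^sup>2"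
      using represents_lower_bound[OF x, of n] Cons.prems by simp
    moreover have "x\<^sup>2 = 1"
      using calculation mult_square_ge[of n c x] False Cons.prems by (cases "x\<^sup>2 = 1") auto
    ultimately have "c = 2 * n \<or> c = n" using Cons.prems by auto
    moreover have "n \<in> set a" if "c = n"
      using represents_small[of a n n] x Cons.prems that \<open>x\<^sup>2 = 1\<close> by auto
    moreover have "count_list a n \<noteq> 0" if "n \<in> set a" using that by (simp add: count_list_0_iff)
    ultimately show ?thesis by auto
  qed
qed simp

lemma subseq_X_or_Y:
  assumes "sorted a" "\<forall>c\<in>set a. n \<le> c" "universal n a" "n > 0"
  shows "subseq (X n) a \<or> subseq (Y n) a"
proof -
  have rep: "represents a m" if "m \<ge> n" for m using assms(3) that by (simp add: universal_def \<T>_def)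
  then have small: "m \<in> set a" if "n \<le> m" "m < 2 * n" for m
    using represents_small[of a m n] assms that by simp
  consider "2 * n \<in> set a" | "2 \<le> count_list a n"
    using represents_double[of a n] rep assms by auto
  then show ?thesis
  proof cases
    case 1
    then have "m \<in> set a" if "n \<le> m" "m \<le> 2 * n" for m
      using small[of m] that by (cases "m = 2 * n") auto
    then show ?thesis
      unfolding X_def using assms(1) by (intro disjI1 sorted_subset_imp_subseq) auto
  next
    case 2
    then obtain c b where a: "a = c # b" by (cases a) auto
    \<comment> \<open>The head is the least entry and \<open>n\<close> occurs, so the head is
      \<open>n\<close>. A second \<open>n\<close> then lies in the tail, which therefore contains
      the whole interval.\<close>
    have "c = n" using small[of n] assms a by fastforce
    then have "n \<in> set b" using 2 count_notin[of n b] a by fastforce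
    then have "m \<in> set b" if "n \<le> m" "m < 2 * n" for m
      using small[of m] that a \<open>c = n\<close> by (cases "m = n") auto
    then have "subseq [n..2 * n - 1] b"
      using assms(1) a by (intro sorted_subset_imp_subseq) auto
    then show ?thesis using a \<open>c = n\<close> by (simp add: Y_def)
  qed
qed

lemma length_X: "n > 0 \<Longrightarrow> length (X n) = nat (n + 1)"
  and length_Y: "n > 0 \<Longrightarrow> length (Y n) = nat (n + 1)"
  by (simp_all add: X_def Y_def Suc_nat_eq_nat_zadd1)

lemma sorted_subseq: "subseq b a \<Longrightarrow> sorted a \<Longrightarrow> sorted b"
  by (induction rule: list_emb.induct) (auto dest: list_emb_set)

lemma new_tight_universalI:
  assumes "n > 0" "sorted a" "\<forall>c\<in>set a. n \<le> c" "universal n a" "length a = nat (n + 1)"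
  shows "new_tight_universal n a"
  unfolding new_tight_universal_def
proof (intro conjI allI impI)
  show "\<forall>c\<in>set a. 0 < c" using assms by fastforce
  show "tight_universal n a"
    using assms represents_lower_bound[of a _ n]
    by (auto simp: tight_universal_def universal_def \<T>_def)
  fix b assume b: "strict_subseq b a"
  show "\<not> universal n b"
  proof
    assume "universal n b"
    have "subseq b a" "b \<noteq> a" using b by (auto simp: strict_subseq_def)
    then have "length b < length a" using subseq_same_length[of b a] list_emb_length[of _ b a] by (cases "length b = length a") fastforce+
    moreover have "subseq (X n) b \<or> subseq (Y n) b"
      by (rule subseq_X_or_Y) (use assms \<open>subseq b a\<close> \<open>universal n b\<close> in
        \<open>auto dest: list_emb_set intro: sorted_subseq\<close>)
    ultimately show False
      using list_emb_length[of _ _ b] length_X length_Y assms by fastforce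
  qed
qed (use assms in simp)

theorem theorem2p7:
  fixes n :: int
  assumes "n > 3"
  shows "{a. new_tight_universal n a} = {X n, Y n} \<and>
         card {a. new_tight_universal n a} = 2"
proof -
  have "new_tight_universal n a \<longleftrightarrow> a = X n \<or> a = Y n" for a
  proof
    assume a: "new_tight_universal n a"
    then have tight: "{m. m \<noteq> 0 \<and> represents a m} = \<T> n" and "sorted a" "\<forall>c\<in>set a. 0 < c"
      by (auto simp: new_tight_universal_def tight_universal_def)
    have rep: "represents a c" if "c \<in> set a" for c
    proof (rule represents_subseq)
      show "subseq [c] a" using that by (simp add: subseq_singleton_left)
      show "represents [c] c" unfolding represents_Cons by (rule exI[of _ 1]) simp
    qed
    have "\<forall>c\<in>set a. n \<le> c"
    proof
      fix c assume "c \<in> set a"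
      then have "c \<in> {m. m \<noteq> 0 \<and> represents a m}" using rep \<open>\<forall>c\<in>set a. 0 < c\<close> by auto
      then show "n \<le> c" unfolding tight by (simp add: \<T>_def)
    qed
    moreover have "universal n a" using tight by (auto simp: universal_def)
    ultimately have "subseq (X n) a \<or> subseq (Y n) a"
      using subseq_X_or_Y \<open>sorted a\<close> assms by simp
    \<comment> \<open>Both lattices are universal, so by minimality neither can be a proper
      subsequence of \<open>a\<close>.\<close>
    then show "a = X n \<or> a = Y n"
      using a universal_X[OF assms] universal_Y[OF assms]
      by (auto simp: new_tight_universal_def strict_subseq_def)
  next
    assume "a = X n \<or> a = Y n"
    moreover have "new_tight_universal n (X n)"
      by (rule new_tight_universalI) (use assms universal_X length_X in \<open>auto simp: X_def\<close>)
    moreover have "new_tight_universal n (Y n)"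
      by (rule new_tight_universalI) (use assms universal_Y length_Y in \<open>auto simp: Y_def\<close>)
    ultimately show "new_tight_universal n a" by auto
  qed
  then have *: "{a. new_tight_universal n a} = {X n, Y n}" by auto
  moreover have "X n \<noteq> Y n"
  proof
    assume "X n = Y n"
    then have "distinct (Y n)" by (metis X_def distinct_upto)
    then show False using assms by (simp add: Y_def)
  qed
  ultimately show ?thesis by simp
qed

end
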